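(* Let $p$ be an odd prime, $\xi$ a primitive $p$th root of unity, and $n\in\mathbb Z$ such that $\mathbb Z[1/n][\xi]$ and $\mathbb Z[1/n][\xi+\xi^{-1}]$ are principal ideal domains and $p\mid n$. Let $P$ be a subgroup of order $p$ in $\mathrm{Sp}(p-1,\mathbb Z[1/n])$ with normalizer $N(P)$ and centralizer $C(P)$. Then the action of $N(P)/C(P)$ on $C(P)$ (by conjugation) is given by the action of the Galois group $\mathrm{Gal}(\mathbb Q(\xi)/\mathbb Q)$ on the unit group $\mathbb Z[1/n][\xi]^*$. Moreover $N(P)/C(P)$ acts faithfully on $C(P)$.
   Context: $\mathrm{Sp}(2m,R)=\{M\in\mathrm{GL}(2m,R): M^{\mathrm T}JM=J\}$ with $J=\begin{pmatrix}0&I_m\\-I_m&0\end{pmatrix}$; normalizer and centralizer are taken in $\mathrm{Sp}(p-1,\mathbb Z[1/n])$. *)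

theory Defs
  imports "HOL-Algebra.Algebra" "Jordan_Normal_Form.Matrix" Complex_Main
begin

definition Zinv :: "int \<Rightarrow> rat set" where
  "Zinv n = {q. \<exists>(a::int) (k::nat). q = of_int a / (of_int n) ^ k}"

definition ring_adjoin :: "complex set \<Rightarrow> complex \<Rightarrow> complex set" where
  "ring_adjoin S x = {(\<Sum>k<d. c k * x ^ k) | d c. \<forall>k<d. c k \<in> S}"

definition Zinv_adj :: "int \<Rightarrow> complex \<Rightarrow> complex set" where
  "Zinv_adj n x = ring_adjoin (of_rat ` Zinv n) x"

text \<open>A subring of the complex numbers (hence an integral domain) is a PID iff every
  ideal is principal.\<close>
definition is_ideal_in :: "complex set \<Rightarrow> complex set \<Rightarrow> bool" where
  "is_ideal_in I R \<longleftrightarrow> I \<subseteq> R \<and> 0 \<in> I \<and> (\<forall>a\<in>I. \<forall>b\<in>I. a - b \<in> I)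
      \<and> (\<forall>r\<in>R. \<forall>a\<in>I. r * a \<in> I)"

definition is_PID :: "complex set \<Rightarrow> bool" where
  "is_PID R \<longleftrightarrow> (\<forall>I. is_ideal_in I R \<longrightarrow> (\<exists>a\<in>R. I = {r * a | r. r \<in> R}))"

definition units_grp :: "complex set \<Rightarrow> complex monoid" where
  "units_grp R = \<lparr>carrier = {u \<in> R. \<exists>v\<in>R. u * v = 1}, Group.monoid.mult = (*), Group.monoid.one = 1\<rparr>"

definition is_subfield :: "complex set \<Rightarrow> bool" where
  "is_subfield F \<longleftrightarrow> 0 \<in> F \<and> 1 \<in> F \<and> (\<forall>a\<in>F. \<forall>b\<in>F. a - b \<in> F \<and> a * b \<in> F)
      \<and> (\<forall>a\<in>F. a \<noteq> 0 \<longrightarrow> inverse a \<in> F)"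

definition Q_adj :: "complex \<Rightarrow> complex set" where
  "Q_adj x = \<Inter>{F. is_subfield F \<and> x \<in> F}"

text \<open>Gal(Q(xi)/Q): field automorphisms of Q(xi) (they automatically fix Q), represented
  as functions that are the identity outside Q(xi); group law is composition.\<close>
definition Gal_grp :: "complex \<Rightarrow> (complex \<Rightarrow> complex) monoid" where
  "Gal_grp x = \<lparr>carrier = {\<sigma>. bij_betw \<sigma> (Q_adj x) (Q_adj x)
       \<and> (\<forall>a\<in>Q_adj x. \<forall>b\<in>Q_adj x. \<sigma> (a + b) = \<sigma> a + \<sigma> b \<and> \<sigma> (a * b) = \<sigma> a * \<sigma> b)
       \<and> (\<forall>a. a \<notin> Q_adj x \<longrightarrow> \<sigma> a = a)},
     Group.monoid.mult = (\<circ>), Group.monoid.one = id\<rparr>"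

definition J_mat :: "nat \<Rightarrow> rat mat" where
  "J_mat m = mat (2*m) (2*m) (\<lambda>(i,j). if i < m \<and> j = i + m then 1
                                      else if m \<le> i \<and> j + m = i then -1 else 0)"

definition Sp_grp :: "nat \<Rightarrow> int \<Rightarrow> rat mat monoid" where
  "Sp_grp m n = \<lparr>carrier = {M \<in> carrier_mat (2*m) (2*m).
        (\<forall>i<2*m. \<forall>j<2*m. M $$ (i,j) \<in> Zinv n) \<and> transpose_mat M * J_mat m * M = J_mat m},
     Group.monoid.mult = (*), Group.monoid.one = 1\<^sub>m (2*m)\<rparr>"

definition normalizer_of :: "('a, 'b) monoid_scheme \<Rightarrow> 'a set \<Rightarrow> 'a set" where
  "normalizer_of G H = {g \<in> carrier G. (\<lambda>h. g \<otimes>\<^bsub>G\<^esub> h \<otimes>\<^bsub>G\<^esub> inv\<^bsub>G\<^esub> g) ` H = H}"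

definition centralizer_of :: "('a, 'b) monoid_scheme \<Rightarrow> 'a set \<Rightarrow> 'a set" where
  "centralizer_of G H = {g \<in> carrier G. \<forall>h\<in>H. g \<otimes>\<^bsub>G\<^esub> h = h \<otimes>\<^bsub>G\<^esub> g}"

end

theory Submission
  imports Defs "Berlekamp_Zassenhaus.Factor_Bound"
begin

text \<open>Let \<open>A\<close> generate \<open>P\<close> and choose \<open>v = A w - w \<noteq> 0\<close>. Irreducibility of the \<open>p\<close>-th cyclotomic
  polynomial makes \<open>v, A v, \<dots>, A\<^sup>p\<^sup>-\<^sup>2 v\<close> a basis of rational \<open>(p-1)\<close>-space, so sending \<open>A\<^sup>k v\<close> to \<open>\<xi>\<^sup>k\<close>
  identifies this space with \<open>\<rat>(\<xi>)\<close>. The algebra of rational matrices commuting with \<open>A\<close> then acts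
  as \<open>\<rat>(\<xi>)\<close> itself, and matrices normalizing \<open>P\<close> act on it by field automorphisms; such an automorphism is
  trivial exactly when the matrix commutes with \<open>A\<close>. Since \<open>p\<close> is invertible in \<open>\<int>[1/n]\<close>, the trace form
  shows that a commuting matrix with entries in \<open>\<int>[1/n]\<close> corresponds to an element of \<open>\<int>[1/n][\<xi>]\<close>.\<close>

section \<open>Rational relations between powers of a root of unity\<close>

text \<open>The obstacle is integrality. The vectors \<open>v\<close>, \<open>A v\<close>, ... form
  a basis over the rationals but need not generate the lattice of vectors over Z[1/n], so the
  coordinates of \<open>c v\<close> are not visibly in Z[1/n] for a matrix \<open>c\<close> over
  Z[1/n]. The trace does not depend on the basis: with \<open>c\<close> written as a rational
  combination of powers of \<open>A\<close>, the difference of two traces of the form tr(c A^m)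
  isolates \<open>p\<close> times one coefficient. The factor \<open>p\<close> is the gap between
  the only possible traces of powers of \<open>A\<close>, namely p - 1 and -1. A Galois automorphism
  lives on all of Q(\<xi>), while conjugation is given on the centralizer only. Conjugation is
  therefore extended to the commutant of \<open>P\<close> among all rational matrices, which the
  normalizer preserves. This depends on \<open>P\<close> alone, so no exponent k with g A g^-1 = A^k
  has to be named. Faithfulness rests on \<open>A\<close> itself lying in the centralizer: acting
  trivially on it already means commuting with \<open>P\<close>.\<close>

lemma eisenstein_irreducible:
  fixes f :: "int poly" and q :: int
  assumes q: "Factorial_Ring.prime q" and deg: "Polynomial.degree f > 0"
    and low: "\<And>i. i < Polynomial.degree f \<Longrightarrow> q dvd Polynomial.coeff f i"
    and lead: "\<not> q dvd Polynomial.lead_coeff f"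
    and const: "\<not> q ^ 2 dvd Polynomial.coeff f 0"
  shows "irreducible\<^sub>d f"
proof (rule irreducible\<^sub>dI)
  show "Polynomial.degree f > 0" by fact
next
  \<comment> \<open>Modulo \<open>q\<close>, the coefficient of \<open>f\<close> at the least index
    where \<open>q\<close> does not divide that of \<open>g\<close> is a product of two units,
    although \<open>q\<close> divides it. At most one factor has a constant term divisible by
    \<open>q\<close>, so this covers every factorization up to a swap.\<close>
  have main: False if gh: "f = g * h" and dh: "Polynomial.degree g < Polynomial.degree f"
    and h0: "\<not> q dvd Polynomial.coeff h 0" for g h :: "int poly"
  proof -
    have "\<not> q dvd Polynomial.lead_coeff g"
      using lead by (auto simp: gh Polynomial.lead_coeff_mult)
    then have ex: "\<not> q dvd Polynomial.coeff g (Polynomial.degree g)" .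
    define i where "i = (LEAST i. \<not> q dvd Polynomial.coeff g i)"
    have i1: "\<not> q dvd Polynomial.coeff g i" unfolding i_def by (rule LeastI, rule ex)
    have i2: "i \<le> Polynomial.degree g" unfolding i_def by (rule Least_le, rule ex)
    have i3: "q dvd Polynomial.coeff g j" if "j < i" for j
      using not_less_Least that unfolding i_def by blast
    have "Polynomial.coeff f i = (\<Sum>j\<le>i. Polynomial.coeff g j * Polynomial.coeff h (i - j))"
      by (simp add: gh Polynomial.coeff_mult)
    also have "{..i} = insert i {..<i}" by auto
    also have "(\<Sum>j\<in>insert i {..<i}. Polynomial.coeff g j * Polynomial.coeff h (i - j)) =
        Polynomial.coeff g i * Polynomial.coeff h 0
        + (\<Sum>j<i. Polynomial.coeff g j * Polynomial.coeff h (i - j))" by simp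
    finally have eq: "Polynomial.coeff g i * Polynomial.coeff h 0 = Polynomial.coeff f i
        - (\<Sum>j<i. Polynomial.coeff g j * Polynomial.coeff h (i - j))" by simp
    have "q dvd (\<Sum>j<i. Polynomial.coeff g j * Polynomial.coeff h (i - j))"
      by (rule dvd_sum) (simp add: i3)
    moreover have "q dvd Polynomial.coeff f i" using low i2 dh by simp
    ultimately have "q dvd Polynomial.coeff g i * Polynomial.coeff h 0" unfolding eq by simp
    with q i1 h0 show False by (simp add: prime_dvd_mult_iff)
  qed
  fix g h :: "int poly"
  assume dg: "Polynomial.degree g < Polynomial.degree f" and dh: "Polynomial.degree h < Polynomial.degree f"
    and gh: "f = g * h"
  have hg: "f = h * g" using gh by (simp add: mult.commute)
  have "Polynomial.coeff f 0 = Polynomial.coeff g 0 * Polynomial.coeff h 0" by (simp add: gh Polynomial.coeff_mult)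
  with const have "\<not> (q dvd Polynomial.coeff g 0 \<and> q dvd Polynomial.coeff h 0)"
    by (auto simp: power2_eq_square intro: mult_dvd_mono)
  then show False using main[OF gh dg] main[OF hg dh] by blast
qed

text \<open>For prime \<open>p\<close> this is the \<open>p\<close>-th cyclotomic polynomial. The
  coefficient ring is left open: Eisenstein's criterion needs the integers, Bezout coefficients need
  the rationals.\<close>

definition prime_cyclotomic :: "nat \<Rightarrow> 'a::comm_ring_1 poly" where
  "prime_cyclotomic p = (\<Sum>k<p. Polynomial.monom 1 k)"

lemma coeff_prime_cyclotomic: "Polynomial.coeff (prime_cyclotomic p) k = (if k < p then 1 else 0)"
  by (simp add: prime_cyclotomic_def Polynomial.coeff_sum sum.delta)

lemma degree_prime_cyclotomic:
  assumes "p > 0" shows "Polynomial.degree (prime_cyclotomic p :: 'a::comm_ring_1 poly) = p - 1"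
proof (rule antisym)
  show "Polynomial.degree (prime_cyclotomic p :: 'a poly) \<le> p - 1"
    by (rule Polynomial.degree_le) (auto simp: coeff_prime_cyclotomic)
  show "p - 1 \<le> Polynomial.degree (prime_cyclotomic p :: 'a poly)"
    by (rule Polynomial.le_degree) (use assms in \<open>auto simp: coeff_prime_cyclotomic\<close>)
qed

text \<open>The geometric sum times x - 1 is x^p - 1; substituting x + 1 for x exposes binomial
  coefficients, the shape to which Eisenstein's criterion applies.\<close>

lemma prime_cyclotomic_shift:
  "[:0, 1:] * pcompose (prime_cyclotomic p) [:1, 1:] = [:1, 1:] ^ p - (1 :: int poly)"
proof -
  have "prime_cyclotomic p = (\<Sum>k<p. [:0, 1:] ^ k :: int poly)"
    unfolding prime_cyclotomic_def by (simp add: Polynomial.monom_altdef)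
  then have "([:0, 1:] - 1) * prime_cyclotomic p = ([:0, 1:] ^ p - 1 :: int poly)"
    using power_diff_1_eq[of "[:0, 1:] :: int poly" p] by (simp only:)
  then have "pcompose (([:0, 1:] - 1) * prime_cyclotomic p) [:1, 1:] = pcompose ([:0, 1:] ^ p - 1 :: int poly) [:1, 1:]"
    by (simp only:)
  moreover have "pcompose [:0, 1:] [:1, 1:] = ([:1, 1:] :: int poly)"
    by (simp add: pcompose_pCons)
  moreover have "[:1, 1:] - 1 = ([:0, 1:] :: int poly)"
    by (rule poly_eqI) (auto simp: coeff_pCons split: nat.split)
  ultimately show ?thesis
    by (simp only: pcompose_mult pcompose_diff pcompose_hom.hom_power pcompose_1)
qed

text \<open>Eisenstein applies after the shift x -> x + 1: the coefficients become
  \<open>p choose Suc k\<close>, all divisible by \<open>p\<close> except the leading 1, with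
  constant term exactly \<open>p\<close>. The shift preserves degrees and products, so
  irreducibility comes back.\<close>

lemma irreducible_prime_cyclotomic_int:
  assumes p: "Factorial_Ring.prime p"
  shows "irreducible\<^sub>d (prime_cyclotomic p :: int poly)"
proof -
  let ?F = "prime_cyclotomic p :: int poly" and ?s = "[:1, 1:] :: int poly"
  define G where "G = pcompose ?F ?s"
  have p2: "p \<ge> 2" using p by (rule prime_ge_2_nat)
  have deg: "Polynomial.degree G = p - 1" using p2 by (simp add: G_def Polynomial.degree_pcompose degree_prime_cyclotomic)
  have coeff: "Polynomial.coeff G k = int (p choose Suc k)" if "k < p" for k
  proof -
    have "Polynomial.coeff G k = Polynomial.coeff ([:0, 1:] * G) (Suc k)" by simp
    also have "\<dots> = Polynomial.coeff ([:1, 1:] ^ p) (Suc k)" unfolding G_def prime_cyclotomic_shift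
      by simp
    also have "\<dots> = int (p choose Suc k)" using that by (subst Polynomial.coeff_linear_poly_power) auto
    finally show ?thesis .
  qed
  have "irreducible\<^sub>d G"
  proof (rule eisenstein_irreducible[of "int p"])
    show "Factorial_Ring.prime (int p)" using p by simp
    show "0 < Polynomial.degree G" using p2 deg by simp
    show "int p dvd Polynomial.coeff G i" if "i < Polynomial.degree G" for i
    proof -
      have "p dvd (p choose Suc i)" using that deg p by (intro dvd_choose_prime) auto
      then show ?thesis using that deg by (simp add: coeff)
    qed
    show "\<not> int p dvd Polynomial.coeff G (Polynomial.degree G)" using p2 by (simp add: deg coeff)
    show "\<not> (int p)\<^sup>2 dvd Polynomial.coeff G 0"
    proof
      assume "(int p)\<^sup>2 dvd Polynomial.coeff G 0"
      then have "int (p\<^sup>2) dvd int p" using p2 by (simp add: coeff)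
      then have "p\<^sup>2 dvd p" by (simp only: int_dvd_int_iff)
      then have "p\<^sup>2 \<le> p" using p2 by (intro dvd_imp_le) auto
      then show False using p2 by (simp add: power2_eq_square)
    qed
  qed
  note irr = irreducible\<^sub>dD(2)[OF this, unfolded G_def]
  show ?thesis
  proof (rule irreducible\<^sub>dI)
    show "0 < Polynomial.degree ?F" using p2 by (simp add: degree_prime_cyclotomic)
    fix g h assume "Polynomial.degree g < Polynomial.degree ?F" "Polynomial.degree h < Polynomial.degree ?F" and gh: "?F = g * h"
    moreover have "pcompose ?F ?s = pcompose g ?s * pcompose h ?s" unfolding gh by (rule pcompose_mult)
    moreover have "Polynomial.degree (pcompose f ?s) = Polynomial.degree f" for f
      by (simp add: Polynomial.degree_pcompose)
    ultimately show False using irr[of "pcompose g ?s" "pcompose h ?s"] by metis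
  qed
qed

text \<open>Gauss's lemma passes from the integers to the rationals.\<close>

lemma irreducible_prime_cyclotomic_rat:
  assumes "Factorial_Ring.prime p"
  shows "irreducible\<^sub>d (prime_cyclotomic p :: rat poly)"
proof -
  have "of_int_poly (prime_cyclotomic p) = (prime_cyclotomic p :: rat poly)"
    by (rule poly_eqI) (simp add: coeff_prime_cyclotomic)
  then show ?thesis
    using irreducible\<^sub>d_int_rat[OF irreducible_prime_cyclotomic_int[OF assms]] by simp
qed

text \<open>The gcd has degree below p - 1, so by irreducibility it is a nonzero constant, which is
  then scaled to 1.\<close>

lemma prime_cyclotomic_bezout:
  fixes f :: "rat poly"
  assumes p: "Factorial_Ring.prime p" and f: "f \<noteq> 0" "Polynomial.degree f < p - 1"
  shows "\<exists>a b. a * f + b * prime_cyclotomic p = 1"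
proof -
  let ?F = "prime_cyclotomic p :: rat poly"
  have p0: "p > 0" using p by (simp add: prime_gt_0_nat)
  define d where "d = gcd f ?F"
  have d0: "d \<noteq> 0" using f unfolding d_def by simp
  obtain e where e: "?F = d * e" unfolding d_def by (metis dvdE gcd_dvd2)
  have dd: "Polynomial.degree d \<le> Polynomial.degree f" unfolding d_def
    by (rule Polynomial.dvd_imp_degree_le) (use f in auto)
  have F0: "?F \<noteq> 0" using irreducible_prime_cyclotomic_rat[OF p] by auto
  then have e0: "e \<noteq> 0" using e by auto
  have dF: "Polynomial.degree ?F = p - 1" using p0 by (rule degree_prime_cyclotomic)
  have "\<not> Polynomial.degree e < Polynomial.degree ?F"
    using irreducible\<^sub>dD(2)[OF irreducible_prime_cyclotomic_rat[OF p], of d e] e dd f dF by auto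
  moreover have "Polynomial.degree ?F = Polynomial.degree d + Polynomial.degree e"
    unfolding e using d0 e0 by (rule Polynomial.degree_mult_eq)
  ultimately have "Polynomial.degree d = 0" by simp
  then obtain c where c: "d = [:c:]" by (metis Polynomial.degree_eq_zeroE)
  then have c0: "c \<noteq> 0" using d0 by auto
  obtain a b where "a * f + b * ?F = d"
    unfolding d_def using bezout_coefficients_fst_snd[of f ?F] by metis
  then have "Polynomial.smult (1/c) (a * f + b * ?F) = Polynomial.smult (1/c) [:c:]" using c by simp
  then have "Polynomial.smult (1/c) a * f + Polynomial.smult (1/c) b * ?F = 1"
    using c0 by (simp add: Polynomial.smult_add_right)
  then show ?thesis by blast
qed

text \<open>The rational polynomials that annihilate a sequence under the shift form an ideal; as the
  cyclotomic polynomial is irreducible, this ideal cannot contain a further nonzero polynomial of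
  smaller degree.\<close>
lemma recurrence_imp_zero:
  fixes s :: "nat \<Rightarrow> 'a::field_char_0" and c :: "nat \<Rightarrow> rat"
  assumes p: "Factorial_Ring.prime p"
    and cyc: "\<And>j. (\<Sum>k<p. s (k + j)) = 0"
    and rel: "\<And>j. (\<Sum>k<p-1. of_rat (c k) * s (k + j)) = 0"
    and k0: "k0 < p - 1" "c k0 \<noteq> 0"
  shows "s j = 0"
proof -
  \<comment> \<open>\<open>E f\<close> is the sequence obtained by applying \<open>f\<close>,
    evaluated at the shift operator, to \<open>s\<close>. Padding the range to any bound above the
    degree makes it visibly linear in \<open>f\<close>.\<close>
  define E where "E f j = (\<Sum>k\<le>Polynomial.degree f. of_rat (Polynomial.coeff f k) * s (k + j))" for f :: "rat poly" and j
  have E: "E f j = (\<Sum>k<m. of_rat (Polynomial.coeff f k) * s (k + j))"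
    if "Polynomial.degree f < m" for f j m
    unfolding E_def
    by (rule sum.mono_neutral_left) (use that in \<open>auto simp: Polynomial.coeff_eq_0\<close>)
  have E_add: "E (f + g) j = E f j + E g j" for f g j
  proof -
    let ?m = "Suc (max (Polynomial.degree f) (Polynomial.degree g))"
    have "Polynomial.degree f < ?m" "Polynomial.degree g < ?m" by auto
    moreover from this have "Polynomial.degree (f + g) < ?m" by (rule Polynomial.degree_add_less)
    ultimately show ?thesis using E[of _ ?m j]
      by (simp add: of_rat_add distrib_right sum.distrib del: sum.lessThan_Suc)
  qed
  have E_smult: "E (Polynomial.smult a f) j = of_rat a * E f j" for a f j
  proof -
    let ?m = "Suc (Polynomial.degree f)"
    have "Polynomial.degree (Polynomial.smult a f) < ?m" "Polynomial.degree f < ?m"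
      using Polynomial.degree_smult_le[of a f] by auto
    then show ?thesis unfolding E[OF \<open>Polynomial.degree (Polynomial.smult a f) < ?m\<close>] E[OF \<open>Polynomial.degree f < ?m\<close>]
      by (simp add: of_rat_mult mult.assoc sum_distrib_left del: sum.lessThan_Suc)
  qed
  have E_shift: "E (pCons 0 f) j = E f (Suc j)" for f j
  proof -
    have "Polynomial.degree (pCons 0 f) < Suc (Suc (Polynomial.degree f))"
      using Polynomial.degree_pCons_le[of 0 f] by linarith
    then have "E (pCons 0 f) j = (\<Sum>k<Suc (Suc (Polynomial.degree f)). of_rat (Polynomial.coeff (pCons 0 f) k) * s (k + j))" by (rule E)
    also have "\<dots> = (\<Sum>k<Suc (Polynomial.degree f). of_rat (Polynomial.coeff f k) * s (k + Suc j))"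
      by (subst sum.lessThan_Suc_shift) simp
    also have "\<dots> = E f (Suc j)" by (rule E[symmetric]) simp
    finally show ?thesis .
  qed
  \<comment> \<open>Multiplying by x moves \<open>j\<close> to \<open>Suc j\<close>, which is
    harmless because the vanishing is assumed for every \<open>j\<close>.\<close>
  have ideal: "E (g * f) j = 0" if "\<And>j. E f j = 0" for f g j
  proof (induction g arbitrary: j)
    case 0
    then show ?case by (simp add: E_def)
  next
    case (pCons a g)
    then show ?case using that by (simp add: Polynomial.mult_pCons_left E_add E_smult E_shift)
  qed
  define f where "f = (\<Sum>k<p-1. Polynomial.monom (c k) k)"
  have cf: "Polynomial.coeff f k = (if k < p - 1 then c k else 0)" for k
    by (simp add: f_def Polynomial.coeff_sum sum.delta)
  have f0: "f \<noteq> 0" using k0 cf[of k0] by auto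
  have "Polynomial.degree f \<le> p - 2" by (rule Polynomial.degree_le) (auto simp: cf)
  then have df: "Polynomial.degree f < p - 1" using k0 by linarith
  obtain a b where ab: "a * f + b * prime_cyclotomic p = 1"
    using prime_cyclotomic_bezout[OF p f0 df] by blast
  have "E f j = 0" for j unfolding E[OF df] using rel[of j] by (simp add: cf)
  moreover have "E (prime_cyclotomic p) j = 0" for j
    using k0 cyc[of j] by (subst E[of _ p]) (simp_all add: degree_prime_cyclotomic coeff_prime_cyclotomic)
  ultimately have "E (a * f + b * prime_cyclotomic p) j = 0"
    by (simp add: E_add ideal)
  \<comment> \<open>The polynomial 1 acts as the identity, so \<open>s\<close> itself
    vanishes.\<close>
  then show ?thesis unfolding ab by (simp add: E_def)
qed

lemma sum_powers_root_of_unity: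
  fixes x :: "'a::field"
  assumes "x ^ p = 1" "x \<noteq> 1" shows "(\<Sum>k<p. x ^ k) = 0"
  using power_diff_1_eq[of x p] assms by simp

text \<open>A relation stays valid after multiplication by \<xi>^j, so the sequence of powers would
  satisfy two coprime recurrences and vanish, although its term at 0 is 1.\<close>

lemma powers_of_root_of_unity_independent:
  fixes \<xi> :: "'a::field_char_0" and c :: "nat \<Rightarrow> rat"
  assumes p: "Factorial_Ring.prime p" and \<xi>: "\<xi> ^ p = 1" "\<xi> \<noteq> 1"
    and rel: "(\<Sum>k<p-1. of_rat (c k) * \<xi> ^ k) = 0" and k: "k < p - 1"
  shows "c k = 0"
proof (rule ccontr)
  assume "c k \<noteq> 0"
  have "\<xi> ^ 0 = 0"
  proof (rule recurrence_imp_zero[where s = "\<lambda>j. \<xi> ^ j" and c = c, OF p _ _ k \<open>c k \<noteq> 0\<close>])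
    show "(\<Sum>k<p. \<xi> ^ (k + j)) = 0" for j
    proof -
      have "(\<Sum>k<p. \<xi> ^ (k + j)) = (\<Sum>k<p. \<xi> ^ k) * \<xi> ^ j" by (simp add: sum_distrib_right power_add)
      then show ?thesis by (simp add: sum_powers_root_of_unity[OF \<xi>])
    qed
    show "(\<Sum>k<p-1. of_rat (c k) * \<xi> ^ (k + j)) = 0" for j
    proof -
      have "(\<Sum>k<p-1. of_rat (c k) * \<xi> ^ (k + j)) = (\<Sum>k<p-1. of_rat (c k) * \<xi> ^ k) * \<xi> ^ j"
        by (simp add: sum_distrib_right power_add mult.assoc)
      then show ?thesis using rel by simp
    qed
  qed
  then show False by simp
qed

section \<open>The cyclotomic module structure\<close>

lemma mat_inverse_exists:
  fixes c :: "'a::field mat"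
  assumes c: "c \<in> carrier_mat N N"
    and ker: "\<And>w. w \<in> carrier_vec N \<Longrightarrow> c *\<^sub>v w = 0\<^sub>v N \<Longrightarrow> w = 0\<^sub>v N"
  shows "\<exists>d\<in>carrier_mat N N. d * c = 1\<^sub>m N \<and> c * d = 1\<^sub>m N"
proof -
  have "det c \<noteq> 0" using det_0_iff_vec_prod_zero_field[OF c] ker by blast
  from det_non_zero_imp_unit[OF c this, of "()"] show ?thesis
    unfolding Units_def ring_mat_def by auto
qed

text \<open>The explicit \<open>N\<close> gives the result the right dimension even for
  \<open>m = 0\<close>.\<close>

definition vec_lincomb :: "nat \<Rightarrow> nat \<Rightarrow> (nat \<Rightarrow> 'a::comm_ring_1) \<Rightarrow> (nat \<Rightarrow> 'a vec) \<Rightarrow> 'a vec" where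
  "vec_lincomb N m c u = vec N (\<lambda>l. \<Sum>k<m. c k * u k $ l)"

lemma vec_lincomb_carrier [simp]: "vec_lincomb N m c u \<in> carrier_vec N"
  by (simp add: vec_lincomb_def)

lemma index_mult_mat_vec_sum:
  assumes "M \<in> carrier_mat N K" "w \<in> carrier_vec K" "i < N"
  shows "(M *\<^sub>v w) $ i = (\<Sum>l<K. M $$ (i, l) * w $ l)"
  using assms by (simp add: scalar_prod_def lessThan_atLeast0)

lemma mult_mat_vec_lincomb:
  assumes M: "M \<in> carrier_mat N N" and u: "\<And>k. k < m \<Longrightarrow> u k \<in> carrier_vec N"
  shows "M *\<^sub>v vec_lincomb N m c u = vec_lincomb N m c (\<lambda>k. M *\<^sub>v u k)"
proof (rule eq_vecI)
  fix i assume "i < dim_vec (vec_lincomb N m c (\<lambda>k. M *\<^sub>v u k))"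
  then have i: "i < N" by (simp add: vec_lincomb_def)
  have "(M *\<^sub>v vec_lincomb N m c u) $ i = (\<Sum>l<N. M $$ (i, l) * (\<Sum>k<m. c k * u k $ l))"
    using index_mult_mat_vec_sum[OF M vec_lincomb_carrier i] by (simp add: vec_lincomb_def)
  also have "\<dots> = (\<Sum>k<m. \<Sum>l<N. M $$ (i, l) * (c k * u k $ l))"
    unfolding sum_distrib_left by (rule sum.swap)
  also have "\<dots> = (\<Sum>k<m. c k * (M *\<^sub>v u k) $ i)"
    by (rule sum.cong[OF refl], subst index_mult_mat_vec_sum[OF M u i])
       (auto simp: sum_distrib_left ac_simps)
  finally show "(M *\<^sub>v vec_lincomb N m c u) $ i = vec_lincomb N m c (\<lambda>k. M *\<^sub>v u k) $ i"
    using i by (simp add: vec_lincomb_def)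
qed (use M in \<open>simp add: vec_lincomb_def\<close>)

lemma pow_mat_commute:
  assumes c: "c \<in> carrier_mat N N" and A: "A \<in> carrier_mat N N" and cA: "c * A = A * c"
  shows "c * A ^\<^sub>m k = A ^\<^sub>m k * c"
proof (induction k)
  case 0
  then show ?case using c A by simp
next
  case (Suc k)
  have Ak: "A ^\<^sub>m k \<in> carrier_mat N N" using A by simp
  have "c * A ^\<^sub>m Suc k = (c * A ^\<^sub>m k) * A" using c Ak A by (simp add: assoc_mult_mat[OF c Ak A])
  also have "\<dots> = A ^\<^sub>m k * (c * A)" unfolding Suc by (rule assoc_mult_mat[OF Ak c A])
  also have "\<dots> = A ^\<^sub>m Suc k * c" unfolding cA using assoc_mult_mat[OF Ak A c] by simp
  finally show ?case .
qed

section \<open>Closure properties of subfields of the complex numbers\<close>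

lemma subfield_add:
  assumes F: "is_subfield F" and ab: "a \<in> F" "b \<in> F" shows "a + b \<in> F"
proof -
  have "0 - b \<in> F" using F ab unfolding is_subfield_def by blast
  then have "a - (0 - b) \<in> F" using F ab unfolding is_subfield_def by blast
  then show ?thesis by simp
qed

lemma subfield_mult: "is_subfield F \<Longrightarrow> a \<in> F \<Longrightarrow> b \<in> F \<Longrightarrow> a * b \<in> F"
  by (simp add: is_subfield_def)

lemma subfield_sum:
  assumes F: "is_subfield F" and "\<And>k. k \<in> I \<Longrightarrow> f k \<in> F"
  shows "sum f I \<in> F"
  using assms(2)
  by (induction I rule: infinite_finite_induct)
     (use F subfield_add[OF F] in \<open>auto simp: is_subfield_def\<close>)

lemma subfield_of_rat:
  assumes F: "is_subfield F" shows "of_rat q \<in> F"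
proof -
  have nat: "of_nat k \<in> F" for k
  proof -
    have "(\<Sum>i<k. 1) \<in> F" by (rule subfield_sum[OF F]) (use F in \<open>simp add: is_subfield_def\<close>)
    then show ?thesis by simp
  qed
  have int: "of_int k \<in> F" for k
  proof (cases k rule: int_cases2)
    case (nonneg n)
    then show ?thesis using nat[of n] by simp
  next
    case (nonpos n)
    have "0 - of_nat n \<in> F" using F nat[of n] unfolding is_subfield_def by blast
    then show ?thesis using nonpos by simp
  qed
  obtain a b where ab: "quotient_of q = (a, b)" by force
  have "b > 0" using ab by (rule quotient_of_denom_pos)
  then have "inverse (of_int b :: complex) \<in> F" using F int[of b] unfolding is_subfield_def by simp
  then have "of_int a * inverse (of_int b :: complex) \<in> F" using F int[of a] unfolding is_subfield_def by blast
  moreover have "of_rat q = of_int a * inverse (of_int b :: complex)"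
    unfolding quotient_of_div[OF ab] of_rat_divide by (simp add: divide_inverse)
  ultimately show ?thesis by simp
qed

lemma subfield_power:
  assumes F: "is_subfield F" "x \<in> F" shows "x ^ k \<in> F"
  by (induction k) (use F in \<open>auto simp: is_subfield_def\<close>)

text \<open>A cyclic vector \<open>v\<close> for a matrix \<open>A\<close> of order \<open>p = N + 1\<close> identifies rational \<open>N\<close>-space
  with the cyclotomic field, in such a way that \<open>A\<close> becomes multiplication by \<open>\<xi>\<close>.\<close>
locale cyclotomic_module =
  fixes N :: nat and A :: "rat mat" and v :: "rat vec" and \<xi> :: complex
  assumes prime_SN: "Factorial_Ring.prime (Suc N)"
    and A [simp]: "A \<in> carrier_mat N N" and A_pow: "A ^\<^sub>m Suc N = 1\<^sub>m N"
    and v [simp]: "v \<in> carrier_vec N" and v_nonzero: "v \<noteq> 0\<^sub>v N"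
    and v_sum: "vec_lincomb N (Suc N) (\<lambda>_. 1) (\<lambda>k. A ^\<^sub>m k *\<^sub>v v) = 0\<^sub>v N"
    and \<xi>_pow: "\<xi> ^ Suc N = 1" and \<xi>_neq: "\<xi> \<noteq> 1"
begin

section \<open>The cyclic basis and its coordinates\<close>

definition e :: "nat \<Rightarrow> rat vec" where "e k = A ^\<^sub>m k *\<^sub>v v"

definition S :: "rat mat" where "S = mat N N (\<lambda>(i, k). e k $ i)"

lemma e_carrier [simp]: "e k \<in> carrier_vec N"
  by (auto simp: e_def intro!: mult_mat_vec_carrier[of _ N N])

lemma dims [simp]: "dim_row A = N" "dim_col A = N" "dim_vec v = N" "dim_vec (e k) = N"
  using carrier_matD[OF A] carrier_vecD[OF v] carrier_vecD[OF e_carrier] by auto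

lemma e_0 [simp]: "e 0 = v" by (simp add: e_def one_mult_mat_vec[OF v])

lemma S_carrier [simp]: "S \<in> carrier_mat N N" by (simp add: S_def)

lemma pow_A_carrier [simp]: "A ^\<^sub>m k \<in> carrier_mat N N" by simp

lemma mult_A_e: "A *\<^sub>v e k = e (Suc k)"
proof -
  have "A * A ^\<^sub>m k = A ^\<^sub>m Suc k" using pow_mat_commute[OF A A refl] by simp
  then show ?thesis unfolding e_def using assoc_mult_mat_vec[OF A pow_A_carrier v, of k] by simp
qed

lemma pow_A_e: "A ^\<^sub>m j *\<^sub>v e k = e (j + k)"
proof (induction j arbitrary: k)
  case 0
  then show ?case by (simp add: one_mult_mat_vec[OF e_carrier])
next
  case (Suc j)
  have "A ^\<^sub>m Suc j *\<^sub>v e k = A ^\<^sub>m j *\<^sub>v (A *\<^sub>v e k)"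
    using assoc_mult_mat_vec[OF pow_A_carrier A e_carrier] by simp
  then show ?case by (simp add: mult_A_e Suc)
qed

lemma e_periodic: "e (k + Suc N) = e k"
  using pow_A_e[of "Suc N" k] unfolding A_pow by (simp add: one_mult_mat_vec[OF e_carrier] add.commute)

lemma e_mod: "e k = e (k mod Suc N)"
proof -
  have "e (r + q * Suc N) = e r" for q r
  proof (induction q)
    case (Suc q)
    have "e (r + Suc q * Suc N) = e ((r + q * Suc N) + Suc N)" by (simp add: algebra_simps)
    also have "\<dots> = e r" unfolding e_periodic Suc by simp
    finally show ?case .
  qed simp
  from this[of "k mod Suc N" "k div Suc N"] show ?thesis by (simp only: mod_div_mult_eq)
qed

lemma e_shift_sum: "vec_lincomb N (Suc N) (\<lambda>_. 1) (\<lambda>k. e (k + j)) = 0\<^sub>v N"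
proof -
  have "A ^\<^sub>m j *\<^sub>v vec_lincomb N (Suc N) (\<lambda>_. 1) e = 0\<^sub>v N"
    using v_sum unfolding e_def[symmetric] by (auto simp: mult_mat_vec_def scalar_prod_def)
  then show ?thesis by (simp only: mult_mat_vec_lincomb[OF pow_A_carrier e_carrier] pow_A_e add.commute)
qed

lemma mult_S: "x \<in> carrier_vec N \<Longrightarrow> S *\<^sub>v x = vec_lincomb N N (($) x) e"
  by (rule eq_vecI) (auto simp: S_def vec_lincomb_def scalar_prod_def lessThan_atLeast0 mult.commute)

text \<open>A kernel vector of \<open>S\<close> is a rational relation among \<open>e 0\<close>,
  ..., \<open>e (N - 1)\<close>. Applying powers of \<open>A\<close> shifts it, so every coordinate
  of the orbit satisfies both this recurrence and the cyclotomic one; a nonzero relation would thus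
  force \<open>v\<close> to be zero.\<close>

lemma S_inverse: "\<exists>T\<in>carrier_mat N N. T * S = 1\<^sub>m N \<and> S * T = 1\<^sub>m N"
proof (rule mat_inverse_exists[OF S_carrier], rule ccontr)
  fix c assume c: "c \<in> carrier_vec N" and Sc: "S *\<^sub>v c = 0\<^sub>v N" and "c \<noteq> 0\<^sub>v N"
  then obtain k where k: "k < N" "c $ k \<noteq> 0" by (metis carrier_vecD eq_vecI index_zero_vec)
  have "v = 0\<^sub>v N"
  proof (rule eq_vecI)
    fix i assume "i < dim_vec (0\<^sub>v N :: rat vec)"
    then have i: "i < N" by simp
    have "e 0 $ i = 0"
    proof (rule recurrence_imp_zero[where s = "\<lambda>j. e j $ i" and c = "($) c", OF prime_SN])
      show "(\<Sum>k<Suc N. e (k + j) $ i) = 0" for j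
        using arg_cong[OF e_shift_sum[of j], of "\<lambda>w. w $ i"] i by (simp add: vec_lincomb_def del: sum.lessThan_Suc)
      show "(\<Sum>k<Suc N - 1. of_rat (c $ k) * e (k + j) $ i) = 0" for j
      proof -
        have "A ^\<^sub>m j *\<^sub>v (S *\<^sub>v c) = 0\<^sub>v N"
          unfolding Sc by (auto simp: mult_mat_vec_def scalar_prod_def)
        then have "vec_lincomb N N (($) c) (\<lambda>k. e (k + j)) = 0\<^sub>v N"
          by (simp only: mult_S[OF c] mult_mat_vec_lincomb[OF pow_A_carrier e_carrier] pow_A_e add.commute)
        from arg_cong[OF this, of "\<lambda>w. w $ i"] show ?thesis using i by (simp add: vec_lincomb_def)
      qed
    qed (use k in auto)
    then show "v $ i = 0\<^sub>v N $ i" using i by simp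
  qed (use v in auto)
  then show False using v_nonzero by simp
qed

text \<open>As the inverse of the change of basis \<open>S\<close>, this matrix turns a vector into
  its coordinates in the cyclic basis.\<close>

definition T :: "rat mat" where "T = (SOME T. T \<in> carrier_mat N N \<and> T * S = 1\<^sub>m N \<and> S * T = 1\<^sub>m N)"

lemma T_carrier [simp]: "T \<in> carrier_mat N N" and TS: "T * S = 1\<^sub>m N" and ST: "S * T = 1\<^sub>m N"
proof -
  have "\<exists>T. T \<in> carrier_mat N N \<and> T * S = 1\<^sub>m N \<and> S * T = 1\<^sub>m N" using S_inverse by blast
  from someI_ex[OF this] show "T \<in> carrier_mat N N" "T * S = 1\<^sub>m N" "S * T = 1\<^sub>m N"
    unfolding T_def by auto
qed

lemma T_mult_carrier [simp]: "w \<in> carrier_vec N \<Longrightarrow> T *\<^sub>v w \<in> carrier_vec N"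
  by (rule mult_mat_vec_carrier[OF T_carrier])

lemma coord_expand: "w \<in> carrier_vec N \<Longrightarrow> vec_lincomb N N (($) (T *\<^sub>v w)) e = w"
  using assoc_mult_mat_vec[OF S_carrier T_carrier, of w]
  by (simp add: ST one_mult_mat_vec mult_S)

lemma coord_lincomb: "x \<in> carrier_vec N \<Longrightarrow> T *\<^sub>v vec_lincomb N N (($) x) e = x"
  using assoc_mult_mat_vec[OF T_carrier S_carrier, of x]
  by (simp add: TS one_mult_mat_vec mult_S)

lemma coord_e: "k < N \<Longrightarrow> T *\<^sub>v e k = unit_vec N k"
proof -
  assume k: "k < N"
  have "vec_lincomb N N (($) (unit_vec N k)) e = e k"
    by (rule eq_vecI) (use k carrier_vecD[OF e_carrier[of k]] in \<open>auto simp: vec_lincomb_def unit_vec_def if_distrib[of "\<lambda>x. x * _"] sum.delta cong: if_cong\<close>)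
  then show ?thesis using coord_lincomb[of "unit_vec N k"] by simp
qed

text \<open>The first orbit vector outside the basis: the vanishing orbit sum makes it minus the sum
  of all basis vectors.\<close>

lemma coord_e_N: "T *\<^sub>v e N = vec N (\<lambda>_. -1)"
proof -
  have "vec_lincomb N N (($) (vec N (\<lambda>_. -1))) e = e N"
  proof (rule eq_vecI)
    fix i assume "i < dim_vec (e N)"
    then have i: "i < N" using e_carrier[of N] by simp
    from arg_cong[OF e_shift_sum[of 0], of "\<lambda>w. w $ i"] i
    show "vec_lincomb N N (($) (vec N (\<lambda>_. -1))) e $ i = e N $ i"
      by (simp add: vec_lincomb_def sum_negf add_eq_0_iff)
  qed (use e_carrier[of N] in \<open>simp add: vec_lincomb_def\<close>)
  then show ?thesis using coord_lincomb[of "vec N (\<lambda>_. -1)"] by simp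
qed

text \<open>The rational-linear identification of \<open>N\<close>-space with Q(\<xi>).\<close>

definition L :: "rat vec \<Rightarrow> complex" where
  "L w = (\<Sum>k<N. of_rat ((T *\<^sub>v w) $ k) * \<xi> ^ k)"

lemma L_add: "w \<in> carrier_vec N \<Longrightarrow> w' \<in> carrier_vec N \<Longrightarrow> L (w + w') = L w + L w'"
  unfolding L_def mult_add_distrib_mat_vec[OF T_carrier]
  using carrier_matD[OF T_carrier] by (simp add: of_rat_add distrib_right sum.distrib)

lemma L_diff: "w \<in> carrier_vec N \<Longrightarrow> w' \<in> carrier_vec N \<Longrightarrow> L (w - w') = L w - L w'"
  unfolding L_def mult_minus_distrib_mat_vec[OF T_carrier]
  using carrier_matD[OF T_carrier] by (simp add: of_rat_diff left_diff_distrib sum_subtractf)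

lemma L_lincomb:
  assumes "\<And>k. k < m \<Longrightarrow> u k \<in> carrier_vec N"
  shows "L (vec_lincomb N m c u) = (\<Sum>k<m. of_rat (c k) * L (u k))"
proof -
  have "T *\<^sub>v vec_lincomb N m c u = vec_lincomb N m c (\<lambda>k. T *\<^sub>v u k)"
    by (rule mult_mat_vec_lincomb[OF T_carrier]) (rule assms)
  then have "L (vec_lincomb N m c u) = (\<Sum>j<N. of_rat (\<Sum>k<m. c k * (T *\<^sub>v u k) $ j) * \<xi> ^ j)"
    unfolding L_def by (simp add: vec_lincomb_def)
  also have "\<dots> = (\<Sum>j<N. \<Sum>k<m. of_rat (c k) * (of_rat ((T *\<^sub>v u k) $ j) * \<xi> ^ j))"
    by (simp only: of_rat_sum of_rat_mult sum_distrib_right mult.assoc)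
  also have "\<dots> = (\<Sum>k<m. \<Sum>j<N. of_rat (c k) * (of_rat ((T *\<^sub>v u k) $ j) * \<xi> ^ j))" by (rule sum.swap)
  finally show ?thesis by (simp only: L_def sum_distrib_left)
qed

lemma L_mult_expand:
  assumes M: "M \<in> carrier_mat N N" and w: "w \<in> carrier_vec N"
  shows "L (M *\<^sub>v w) = (\<Sum>k<N. of_rat ((T *\<^sub>v w) $ k) * L (M *\<^sub>v e k))"
proof -
  have "M *\<^sub>v w = M *\<^sub>v vec_lincomb N N (($) (T *\<^sub>v w)) e" using coord_expand[OF w] by simp
  also have "\<dots> = vec_lincomb N N (($) (T *\<^sub>v w)) (\<lambda>k. M *\<^sub>v e k)"
    by (rule mult_mat_vec_lincomb[OF M e_carrier])
  finally show ?thesis using L_lincomb[of N "\<lambda>k. M *\<^sub>v e k"] M by simp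
qed

text \<open>The boundary case \<open>k = N\<close> is the one that matters: there \<open>e N\<close>
  and \<xi>^N are the same combination of the lower terms, and this lets \<open>L\<close> turn
  \<open>A\<close> into multiplication by \<xi> on the last basis vector too.\<close>

lemma L_e: assumes "k \<le> N" shows "L (e k) = \<xi> ^ k"
proof (cases "k = N")
  case True
  have "(\<Sum>k<Suc N. \<xi> ^ k) = 0" by (rule sum_powers_root_of_unity[OF \<xi>_pow \<xi>_neq])
  then show ?thesis using True by (simp add: L_def coord_e_N sum_negf add_eq_0_iff)
next
  case False
  with assms have "k < N" by simp
  then show ?thesis by (simp add: L_def coord_e unit_vec_def if_distrib[of of_rat] if_distrib[of "\<lambda>x. x * _"] sum.delta cong: if_cong)
qed

lemma L_A: assumes w: "w \<in> carrier_vec N" shows "L (A *\<^sub>v w) = \<xi> * L w"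
  unfolding L_mult_expand[OF A w] by (simp add: mult_A_e L_e L_def[of w] sum_distrib_left mult.left_commute)

lemma L_A_pow: "w \<in> carrier_vec N \<Longrightarrow> L (A ^\<^sub>m k *\<^sub>v w) = \<xi> ^ k * L w"
proof (induction k arbitrary: w)
  case 0
  then show ?case using carrier_matD[OF A] by simp
next
  case (Suc k)
  have "A ^\<^sub>m Suc k *\<^sub>v w = A ^\<^sub>m k *\<^sub>v (A *\<^sub>v w)"
    using assoc_mult_mat_vec[OF pow_A_carrier A Suc.prems] by simp
  then show ?case using Suc.IH[OF mult_mat_vec_carrier[OF A Suc.prems]] L_A[OF Suc.prems] by simp
qed

lemma L_eq_0: assumes w: "w \<in> carrier_vec N" and Lw: "L w = 0" shows "w = 0\<^sub>v N"
proof -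
  have "(T *\<^sub>v w) $ k = 0" if "k < N" for k
    using powers_of_root_of_unity_independent[OF prime_SN \<xi>_pow \<xi>_neq, of "($) (T *\<^sub>v w)" k] Lw that
    by (simp add: L_def)
  then have "vec_lincomb N N (($) (T *\<^sub>v w)) e = 0\<^sub>v N"
    by (intro eq_vecI) (auto simp: vec_lincomb_def)
  then show ?thesis using coord_expand[OF w] by simp
qed

section \<open>The commutant of \<open>A\<close> as a copy of the cyclotomic field\<close>

definition K :: "rat mat set" where "K = {c \<in> carrier_mat N N. c * A = A * c}"

text \<open>A matrix in \<open>K\<close> is determined by its value at the cyclic vector; since
  \<open>L v = 1\<close>, this number is also the factor by which the matrix acts once
  \<open>L\<close> is applied.\<close>

definition \<Phi> :: "rat mat \<Rightarrow> complex" where "\<Phi> c = L (c *\<^sub>v v)"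

lemma K_carrier: "c \<in> K \<Longrightarrow> c \<in> carrier_mat N N" by (simp add: K_def)

lemma K_mult_v: "c \<in> K \<Longrightarrow> c *\<^sub>v v \<in> carrier_vec N"
  by (rule mult_mat_vec_carrier[OF K_carrier v])

lemma K_mult_e: assumes c: "c \<in> K" shows "c *\<^sub>v e k = A ^\<^sub>m k *\<^sub>v (c *\<^sub>v v)"
proof -
  have "c * A ^\<^sub>m k = A ^\<^sub>m k * c" by (rule pow_mat_commute[OF K_carrier[OF c] A]) (use c in \<open>simp add: K_def\<close>)
  then show ?thesis unfolding e_def
    using assoc_mult_mat_vec[OF K_carrier[OF c] pow_A_carrier v, of k]
      assoc_mult_mat_vec[OF pow_A_carrier K_carrier[OF c] v, of k] by simp
qed

text \<open>Commuting with \<open>A\<close> gives c A^k v = A^k c v, so the claim holds on the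
  cyclic basis and extends linearly.\<close>

lemma L_K: assumes c: "c \<in> K" and w: "w \<in> carrier_vec N" shows "L (c *\<^sub>v w) = \<Phi> c * L w"
proof -
  have "c *\<^sub>v v \<in> carrier_vec N" by (rule mult_mat_vec_carrier[OF K_carrier[OF c] v])
  then show ?thesis
    unfolding L_mult_expand[OF K_carrier[OF c] w] K_mult_e[OF c]
    by (simp add: L_A_pow \<Phi>_def L_def[of w] sum_distrib_left mult_ac)
qed

lemma \<Phi>_mult: "c \<in> K \<Longrightarrow> d \<in> K \<Longrightarrow> \<Phi> (c * d) = \<Phi> c * \<Phi> d"
  using L_K[of c "d *\<^sub>v v"] by (simp add: \<Phi>_def assoc_mult_mat_vec[OF K_carrier K_carrier v] K_mult_v)

lemma \<Phi>_add: "c \<in> K \<Longrightarrow> d \<in> K \<Longrightarrow> \<Phi> (c + d) = \<Phi> c + \<Phi> d"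
  by (simp add: \<Phi>_def add_mult_distrib_mat_vec[OF K_carrier K_carrier v] L_add K_mult_v)

lemma \<Phi>_diff: "c \<in> K \<Longrightarrow> d \<in> K \<Longrightarrow> \<Phi> (c - d) = \<Phi> c - \<Phi> d"
  by (simp add: \<Phi>_def minus_mult_distrib_mat_vec[OF K_carrier K_carrier v] L_diff K_mult_v)

lemma \<Phi>_1: "\<Phi> (1\<^sub>m N) = 1" using L_e[of 0] by (simp add: \<Phi>_def)

lemma \<Phi>_A: "\<Phi> A = \<xi>" using L_A[of v] L_e[of 0] by (simp add: \<Phi>_def)

lemma K_1: "1\<^sub>m N \<in> K" and K_A: "A \<in> K"
  by (simp_all add: K_def left_mult_one_mat[OF A] right_mult_one_mat[OF A])

lemma K_mult: assumes c: "c \<in> K" and d: "d \<in> K" shows "c * d \<in> K"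
proof -
  note cc = K_carrier[OF c] and dc = K_carrier[OF d]
  have "c * d * A = c * (A * d)" using d assoc_mult_mat[OF cc dc A] by (simp add: K_def)
  also have "\<dots> = A * c * d" using c assoc_mult_mat[OF cc A dc] by (simp add: K_def)
  also have "\<dots> = A * (c * d)" by (rule assoc_mult_mat[OF A cc dc])
  finally show ?thesis using mult_carrier_mat[OF cc dc] by (simp add: K_def)
qed

lemma K_add: "c \<in> K \<Longrightarrow> d \<in> K \<Longrightarrow> c + d \<in> K"
  using add_mult_distrib_mat[of c N N d A N] mult_add_distrib_mat[of A N N c N d] by (simp add: K_def)

lemma K_diff: "c \<in> K \<Longrightarrow> d \<in> K \<Longrightarrow> c - d \<in> K"
  using minus_mult_distrib_mat[of c N N d A N] mult_minus_distrib_mat[of A N N c N d]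
  by (simp add: K_def minus_carrier_mat)

lemma mult_S_mat: assumes "M \<in> carrier_mat N N" "i < N" "k < N"
  shows "(M * S) $$ (i, k) = (M *\<^sub>v e k) $ i"
proof -
  have "col S k = e k" by (rule eq_vecI) (use assms carrier_vecD[OF e_carrier[of k]] in \<open>auto simp: S_def\<close>)
  then show ?thesis using assms carrier_matD[OF S_carrier] by simp
qed

text \<open>Equal values make the matrices agree at \<open>v\<close>, since \<open>L\<close> is
  injective; commuting with \<open>A\<close> spreads the agreement to the whole cyclic
  basis.\<close>

lemma inj_on_\<Phi>: "inj_on \<Phi> K"
proof (rule inj_onI)
  fix c d assume c: "c \<in> K" and d: "d \<in> K" and eq: "\<Phi> c = \<Phi> d"
  have cd: "c - d \<in> K" using c d by (rule K_diff)
  have "(c - d) *\<^sub>v v = 0\<^sub>v N"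
    by (rule L_eq_0) (use \<Phi>_diff[OF c d] eq mult_mat_vec_carrier[OF K_carrier[OF cd] v] in \<open>auto simp: \<Phi>_def\<close>)
  moreover have "(c - d) *\<^sub>v v = c *\<^sub>v v - d *\<^sub>v v"
    by (rule minus_mult_distrib_mat_vec[OF K_carrier[OF c] K_carrier[OF d] v])
  moreover have "c *\<^sub>v v \<in> carrier_vec N" "d *\<^sub>v v \<in> carrier_vec N"
    using mult_mat_vec_carrier[OF K_carrier v] c d by auto
  ultimately have "c *\<^sub>v v = d *\<^sub>v v" by (intro eq_vecI) (use K_carrier[OF c] K_carrier[OF d] in \<open>auto simp: vec_eq_iff\<close>)
  then have "c *\<^sub>v e k = d *\<^sub>v e k" for k by (simp add: K_mult_e c d)
  then have cS: "c * S = d * S"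
    by (intro eq_matI) (use K_carrier[OF c] K_carrier[OF d] S_carrier in \<open>auto simp: mult_S_mat simp del: index_mult_mat(1)\<close>)
  have "c = c * S * T" "d = d * S * T"
    using assoc_mult_mat[OF K_carrier S_carrier T_carrier] right_mult_one_mat[OF K_carrier] c d ST by auto
  then show "c = d" using cS by simp
qed

text \<open>Commutativity is pulled back from the complex numbers along the injective multiplicative
  map \<open>\<Phi>\<close>.\<close>

lemma K_commute: "c \<in> K \<Longrightarrow> d \<in> K \<Longrightarrow> c * d = d * c"
  using inj_onD[OF inj_on_\<Phi>, of "c * d" "d * c"] by (simp add: \<Phi>_mult K_mult mult.commute)

lemma K_inv:
  assumes c: "c \<in> K" and d: "d \<in> carrier_mat N N" "d * c = 1\<^sub>m N" "c * d = 1\<^sub>m N"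
  shows "d \<in> K"
proof -
  note cc = K_carrier[OF c]
  note assoc = assoc_mult_mat[of _ N N _ N _ N]
  have "d * A = d * A * (c * d)" using d right_mult_one_mat[of "d * A" N N] by simp
  also have "\<dots> = d * (A * c) * d" using d cc mult_carrier_mat[OF d(1) A] mult_carrier_mat[OF A cc]
    by (simp add: assoc)
  also have "A * c = c * A" using c by (simp add: K_def)
  also have "d * (c * A) = d * c * A" using assoc_mult_mat[OF d(1) cc A] ..
  also have "d * c * A * d = A * d" unfolding d(2) by (simp add: left_mult_one_mat[OF A])
  finally show ?thesis using d by (simp add: K_def)
qed

lemma K_inverse: assumes c: "c \<in> K" and c0: "\<Phi> c \<noteq> 0"
  shows "\<exists>d\<in>K. d * c = 1\<^sub>m N \<and> c * d = 1\<^sub>m N"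
proof -
  note cc = K_carrier[OF c]
  have L0: "L (0\<^sub>v N) = 0" using L_diff[of v v] minus_cancel_vec[OF v] by simp
  have "\<exists>d\<in>carrier_mat N N. d * c = 1\<^sub>m N \<and> c * d = 1\<^sub>m N"
  proof (rule mat_inverse_exists[OF cc])
    fix w :: "rat vec" assume w: "w \<in> carrier_vec N" and "c *\<^sub>v w = 0\<^sub>v N"
    then have "\<Phi> c * L w = 0" using L_K[OF c w] L0 by simp
    then show "w = 0\<^sub>v N" using L_eq_0[OF w] c0 by simp
  qed
  then show ?thesis using K_inv[OF c] by blast
qed

lemma \<Phi>_in_subfield: "is_subfield F \<Longrightarrow> \<xi> \<in> F \<Longrightarrow> \<Phi> c \<in> F"
  unfolding \<Phi>_def L_def
  by (rule subfield_sum) (use subfield_of_rat subfield_power in \<open>auto simp: is_subfield_def\<close>)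

text \<open>Each value is a rational combination of powers of \<xi>, hence lies in every subfield
  containing \<xi>. Conversely the image is itself such a subfield, with inverses supplied by
  invertible matrices in \<open>K\<close>.\<close>

lemma image_\<Phi>: "\<Phi> ` K = Q_adj \<xi>"
proof
  show "\<Phi> ` K \<subseteq> Q_adj \<xi>" unfolding Q_adj_def using \<Phi>_in_subfield by blast
  have "is_subfield (\<Phi> ` K)"
    unfolding is_subfield_def
  proof (intro conjI ballI impI)
    show "0 \<in> \<Phi> ` K" using \<Phi>_diff[OF K_1 K_1] K_diff[OF K_1 K_1] by (metis diff_self image_eqI)
    show "1 \<in> \<Phi> ` K" using \<Phi>_1 K_1 by (metis image_eqI)
    fix a assume "a \<in> \<Phi> ` K"
    then obtain c where c: "c \<in> K" "a = \<Phi> c" by blast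
    show "inverse a \<in> \<Phi> ` K" if a0: "a \<noteq> 0"
    proof -
      obtain d where d: "d \<in> K" "d * c = 1\<^sub>m N" using K_inverse[OF c(1)] c(2) a0 by auto
      then have "\<Phi> d * a = 1" using \<Phi>_mult[OF d(1) c(1)] \<Phi>_1 c by simp
      then have "inverse a = \<Phi> d" by (metis inverse_unique mult.commute)
      then show ?thesis using d by blast
    qed
    fix b assume "b \<in> \<Phi> ` K"
    then obtain d where d: "d \<in> K" "b = \<Phi> d" by blast
    show "a - b \<in> \<Phi> ` K" using \<Phi>_diff[OF c(1) d(1)] K_diff[OF c(1) d(1)] c d by (metis image_eqI)
    show "a * b \<in> \<Phi> ` K" using \<Phi>_mult[OF c(1) d(1)] K_mult[OF c(1) d(1)] c d by (metis image_eqI)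
  qed
  moreover have "\<xi> \<in> \<Phi> ` K" using \<Phi>_A K_A by (metis image_eqI)
  ultimately show "Q_adj \<xi> \<subseteq> \<Phi> ` K" unfolding Q_adj_def by blast
qed

end

section \<open>Integrality\<close>

lemma Zinv_of_int: "of_int a \<in> Zinv n"
  unfolding Zinv_def by (rule CollectI, rule exI[of _ a], rule exI[of _ 0]) simp

lemma Zinv_add:
  assumes n: "n \<noteq> 0" and "x \<in> Zinv n" "y \<in> Zinv n" shows "x + y \<in> Zinv n"
proof -
  obtain a k b l where x: "x = of_int a / of_int n ^ k" and y: "y = of_int b / of_int n ^ l"
    using assms unfolding Zinv_def by blast
  have "x + y = of_int (a * n ^ l + b * n ^ k) / of_int n ^ (k + l)"
    using n by (simp add: x y add_frac_eq power_add)
  then show ?thesis unfolding Zinv_def by blast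
qed

lemma Zinv_mult:
  assumes "x \<in> Zinv n" "y \<in> Zinv n" shows "x * y \<in> Zinv n"
proof -
  obtain a k b l where x: "x = of_int a / of_int n ^ k" and y: "y = of_int b / of_int n ^ l"
    using assms unfolding Zinv_def by blast
  have "x * y = of_int (a * b) / of_int n ^ (k + l)" by (simp add: x y power_add)
  then show ?thesis unfolding Zinv_def by blast
qed

lemma Zinv_uminus: "x \<in> Zinv n \<Longrightarrow> - x \<in> Zinv n"
  using Zinv_mult[OF Zinv_of_int[of "-1"]] by simp

lemma Zinv_diff: "n \<noteq> 0 \<Longrightarrow> x \<in> Zinv n \<Longrightarrow> y \<in> Zinv n \<Longrightarrow> x - y \<in> Zinv n"
  using Zinv_add[of n x "- y"] Zinv_uminus[of y n] by simp

lemma Zinv_sum: "n \<noteq> 0 \<Longrightarrow> (\<And>k. k \<in> I \<Longrightarrow> f k \<in> Zinv n) \<Longrightarrow> sum f I \<in> Zinv n"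
  by (induction I rule: infinite_finite_induct)
     (use Zinv_of_int[of 0 n] in \<open>auto intro: Zinv_add\<close>)

text \<open>This is where divisibility of \<open>n\<close> by \<open>p\<close> enters: with
  \<open>q = p\<close> it permits division by \<open>p\<close> in the trace argument.\<close>

lemma Zinv_inverse_dvd:
  assumes "n \<noteq> 0" "q dvd n" shows "1 / of_int q \<in> Zinv n"
proof -
  obtain m where m: "n = q * m" using assms by blast
  have "1 / of_int q = (of_int m :: rat) / of_int n ^ 1" using assms by (simp add: m)
  then show ?thesis unfolding Zinv_def by blast
qed

definition entries_in :: "'a set \<Rightarrow> 'a mat \<Rightarrow> bool" where
  "entries_in R M \<longleftrightarrow> (\<forall>i<dim_row M. \<forall>j<dim_col M. M $$ (i, j) \<in> R)"

lemma entries_in_mult: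
  assumes n: "n \<noteq> 0" and M: "entries_in (Zinv n) M" "entries_in (Zinv n) M'" and d: "dim_col M = dim_row M'"
  shows "entries_in (Zinv n) (M * M')"
  unfolding entries_in_def
proof (intro allI impI)
  fix i j assume "i < dim_row (M * M')" "j < dim_col (M * M')"
  then show "(M * M') $$ (i, j) \<in> Zinv n" using M d n
    by (auto simp: scalar_prod_def entries_in_def intro!: Zinv_sum Zinv_mult)
qed

lemma entries_in_one: "entries_in (Zinv n) (1\<^sub>m N)"
  using Zinv_of_int[of 0 n] Zinv_of_int[of 1 n] by (auto simp: entries_in_def)

lemma entries_in_pow:
  assumes "n \<noteq> 0" "entries_in (Zinv n) M" "M \<in> carrier_mat N N"
  shows "entries_in (Zinv n) (M ^\<^sub>m k)"
  by (induction k) (use assms entries_in_one in \<open>auto intro: entries_in_mult\<close>)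

section \<open>Traces and the integrality of coordinates\<close>

definition mat_trace :: "'a::comm_ring_1 mat \<Rightarrow> 'a" where
  "mat_trace M = (\<Sum>i<dim_row M. M $$ (i, i))"

lemma mat_trace_commute:
  assumes "I \<in> carrier_mat N N" "Y \<in> carrier_mat N N"
  shows "mat_trace (I * Y) = mat_trace (Y * I)"
proof -
  have "mat_trace (I * Y) = (\<Sum>i<N. \<Sum>j<N. I $$ (i, j) * Y $$ (j, i))"
    using assms by (simp add: mat_trace_def scalar_prod_def lessThan_atLeast0)
  also have "\<dots> = (\<Sum>j<N. \<Sum>i<N. I $$ (i, j) * Y $$ (j, i))" by (rule sum.swap)
  also have "\<dots> = mat_trace (Y * I)"
    using assms by (simp add: mat_trace_def scalar_prod_def lessThan_atLeast0 mult.commute)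
  finally show ?thesis .
qed

context cyclotomic_module
begin

lemma coord_e_le: assumes "r \<le> N" "i < N"
  shows "(T *\<^sub>v e r) $ i = (if r = N then -1 else if r = i then 1 else 0)"
  using assms by (cases "r = N") (auto simp: coord_e coord_e_N)

text \<open>The left side is the trace of A^l computed in the cyclic basis. The values match the
  field trace of \<xi>^l: p - 1 when \<xi>^l = 1, otherwise -1.\<close>

lemma trace_pow_A:
  "(\<Sum>i<N. (T *\<^sub>v e (l + i)) $ i) = (if l mod Suc N = 0 then of_nat N else -1)"
proof -
  let ?r = "l mod Suc N"
  have coord: "(T *\<^sub>v e (l + i)) $ i = (if (?r + i) mod Suc N = N then -1 else if (?r + i) mod Suc N = i then 1 else 0)"
    if i: "i < N" for i
  proof -
    have "(l + i) mod Suc N = (?r + i) mod Suc N" by (simp add: mod_add_left_eq)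
    then have "e (l + i) = e ((?r + i) mod Suc N)" using e_mod[of "l + i"] by simp
    moreover have "(?r + i) mod Suc N \<le> N" by (simp add: less_Suc_eq_le[symmetric])
    ultimately show ?thesis using coord_e_le i by simp
  qed
  show ?thesis
  proof (cases "?r = 0")
    case True
    then have "(\<Sum>i<N. (T *\<^sub>v e (l + i)) $ i) = (\<Sum>i<N. 1)"
      by (intro sum.cong[OF refl]) (simp add: coord)
    then show ?thesis using True by simp
  next
    case False
    have r: "?r \<le> N" by (simp add: less_Suc_eq_le[symmetric])
    \<comment> \<open>A shift by a nonzero residue fixes no index, so the diagonal has no entry 1.
      The only contribution comes from the column sent to \<open>e N\<close>, whose coordinates are
      all -1.\<close>
    have "(T *\<^sub>v e (l + i)) $ i = (if i = N - ?r then -1 else 0)" if i: "i < N" for i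
    proof (cases "?r + i \<le> N")
      case True
      then show ?thesis using coord[OF i] False i by auto
    next
      case gt: False
      then have "(?r + i) mod Suc N = ?r + i - Suc N" using r i le_mod_geq[of "Suc N" "?r + i"] mod_less[of "?r + i - Suc N" "Suc N"] by linarith
      then have "(?r + i) mod Suc N \<noteq> N" "(?r + i) mod Suc N \<noteq> i" "i \<noteq> N - ?r"
        using gt r i by linarith+
      then show ?thesis using coord[OF i] by simp
    qed
    then have "(\<Sum>i<N. (T *\<^sub>v e (l + i)) $ i) = (\<Sum>i<N. if i = N - ?r then -1 else 0)"
      by (intro sum.cong[OF refl]) simp
    also have "\<dots> = -1"
    proof -
      have "N - ?r < N" using False r by linarith
      then show ?thesis by simp
    qed
    finally show ?thesis using False by simp
  qed
qed

lemma col_mult_S: "M \<in> carrier_mat N N \<Longrightarrow> i < N \<Longrightarrow> col (M * S) i = M *\<^sub>v e i"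
  by (rule eq_vecI) (auto simp: mult_S_mat carrier_matD[OF S_carrier] simp del: index_mult_mat(1) index_mult_mat_vec)

text \<open>With x the coordinates of \<open>c v\<close>, the matrix \<open>c\<close> acts as the
  sum of the x_k A^k; the formula is linearity of the trace applied to c A^m.\<close>

lemma trace_K:
  assumes c: "c \<in> K"
  shows "mat_trace (c * A ^\<^sub>m m) =
    (\<Sum>k<N. (T *\<^sub>v (c *\<^sub>v v)) $ k * (if (k + m) mod Suc N = 0 then of_nat N else -1))"
proof -
  let ?x = "T *\<^sub>v (c *\<^sub>v v)" and ?M = "c * A ^\<^sub>m m"
  have cc: "c \<in> carrier_mat N N" using c by (rule K_carrier)
  have M: "?M \<in> carrier_mat N N" by (rule mult_carrier_mat[OF cc pow_A_carrier])
  have MS: "?M * S \<in> carrier_mat N N" by (rule mult_carrier_mat[OF M S_carrier])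
  have Me: "?M *\<^sub>v e i = vec_lincomb N N (($) ?x) (\<lambda>k. e (m + i + k))" for i
  proof -
    have "?M *\<^sub>v e i = c *\<^sub>v e (m + i)" using assoc_mult_mat_vec[OF cc pow_A_carrier e_carrier] by (simp add: pow_A_e)
    also have "\<dots> = A ^\<^sub>m (m + i) *\<^sub>v vec_lincomb N N (($) ?x) e"
      unfolding K_mult_e[OF c] coord_expand[OF K_mult_v[OF c]] ..
    also have "\<dots> = vec_lincomb N N (($) ?x) (\<lambda>k. e (m + i + k))"
      by (simp add: mult_mat_vec_lincomb[OF pow_A_carrier e_carrier] pow_A_e)
    finally show ?thesis .
  qed
  have diag: "(T * (?M * S)) $$ (i, i) = (\<Sum>k<N. ?x $ k * (T *\<^sub>v e (k + m + i)) $ i)" if i: "i < N" for i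
  proof -
    have "col (?M * S) i = ?M *\<^sub>v e i"
      using M i by (rule col_mult_S)
    then have "(T * (?M * S)) $$ (i, i) = (T *\<^sub>v (?M *\<^sub>v e i)) $ i"
      using i MS carrier_matD[OF T_carrier] carrier_matD[OF MS] by simp
    also have "\<dots> = vec_lincomb N N (($) ?x) (\<lambda>k. T *\<^sub>v e (m + i + k)) $ i"
      unfolding Me by (simp only: mult_mat_vec_lincomb[OF T_carrier e_carrier])
    also have "\<dots> = (\<Sum>k<N. ?x $ k * (T *\<^sub>v e (k + m + i)) $ i)"
      using i by (simp add: vec_lincomb_def ac_simps)
    finally show ?thesis .
  qed
  \<comment> \<open>Rotating \<open>T\<close> to the front computes the trace in the cyclic
    basis.\<close>
  have "?M = (?M * S) * T" using assoc_mult_mat[OF M S_carrier T_carrier] right_mult_one_mat[OF M] ST by simp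
  then have "mat_trace ?M = mat_trace (T * (?M * S))" using mat_trace_commute[OF MS T_carrier] by simp
  also have "\<dots> = (\<Sum>i<N. \<Sum>k<N. ?x $ k * (T *\<^sub>v e (k + m + i)) $ i)"
    unfolding mat_trace_def using carrier_matD[OF T_carrier] by (intro sum.cong) (simp_all add: diag del: index_mult_mat(1))
  also have "\<dots> = (\<Sum>k<N. \<Sum>i<N. ?x $ k * (T *\<^sub>v e (k + m + i)) $ i)" by (rule sum.swap)
  also have "\<dots> = (\<Sum>k<N. ?x $ k * (\<Sum>i<N. (T *\<^sub>v e (k + m + i)) $ i))" by (simp only: sum_distrib_left)
  finally show ?thesis by (simp only: trace_pow_A)
qed

text \<open>The trace form is dual to the powers of \<open>A\<close> up to the factor \<open>p = N + 1\<close>, which is a unit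
  in \<open>\<int>[1/n]\<close>; hence the coefficients of an integral matrix are integral.\<close>
lemma coord_in_Zinv:
  assumes n: "n \<noteq> 0" "int (Suc N) dvd n" and c: "c \<in> K"
    and ent: "entries_in (Zinv n) c" "entries_in (Zinv n) A" and j: "j < N"
  shows "(T *\<^sub>v (c *\<^sub>v v)) $ j \<in> Zinv n"
proof -
  let ?x = "\<lambda>k. (T *\<^sub>v (c *\<^sub>v v)) $ k"
  have tr: "mat_trace (c * A ^\<^sub>m m) \<in> Zinv n" for m
  proof -
    have "entries_in (Zinv n) (c * A ^\<^sub>m m)"
      by (rule entries_in_mult[OF n(1) ent(1) entries_in_pow[OF n(1) ent(2) A]])
         (use K_carrier[OF c] in simp)
    then show ?thesis unfolding mat_trace_def using K_carrier[OF c]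
      by (intro Zinv_sum[OF n(1)]) (auto simp: entries_in_def simp del: index_mult_mat(1))
  qed
  \<comment> \<open>The exponent \<open>Suc N - j\<close> stands for -j modulo \<open>p\<close>, so
    only \<open>k = j\<close> meets the exceptional trace.\<close>
  have mod1: "(k + (Suc N - j)) mod Suc N = 0 \<longleftrightarrow> k = j" if "k < N" for k
  proof (cases "k < j")
    case True
    then have "(k + (Suc N - j)) mod Suc N = k + (Suc N - j)" using j by (intro mod_less) auto
    then show ?thesis using True j by simp
  next
    case False
    then have "k + (Suc N - j) = (k - j) + Suc N" using j by simp
    then have "(k + (Suc N - j)) mod Suc N = (k - j) mod Suc N" by (simp only: mod_add_self2)
    also have "\<dots> = k - j" using that by (intro mod_less) auto
    finally show ?thesis using False by simp
  qed
  have mod2: "(k + 1) mod Suc N \<noteq> 0" if "k < N" for k using that by simp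
  \<comment> \<open>With exponent 1 no index \<open>k < N\<close> reaches 0 modulo \<open>p\<close>,
    so that trace is minus the sum of all coordinates. Subtracting it cancels everything except
    \<open>p\<close> times the \<open>j\<close>-th.\<close>
  have "mat_trace (c * A ^\<^sub>m (Suc N - j)) - mat_trace (c * A ^\<^sub>m 1)
      = (\<Sum>k<N. ?x k * (if k = j then of_nat N else -1)) - (\<Sum>k<N. ?x k * (-1))"
    unfolding trace_K[OF c] by (intro arg_cong2[where f = minus] sum.cong refl) (simp_all only: mod1 mod2 lessThan_iff if_False)
  also have "\<dots> = (\<Sum>k<N. if k = j then of_nat (Suc N) * ?x k else 0)"
    unfolding sum_subtractf[symmetric] by (intro sum.cong refl) (simp add: algebra_simps)
  also have "\<dots> = of_nat (Suc N) * ?x j" using j by (simp add: sum.delta)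
  finally have "?x j = (mat_trace (c * A ^\<^sub>m (Suc N - j)) - mat_trace (c * A ^\<^sub>m 1)) * (1 / of_int (int (Suc N)))"
    by (simp del: of_nat_Suc)
  then show ?thesis
    using Zinv_mult[OF Zinv_diff[OF n(1) tr tr] Zinv_inverse_dvd[OF n]] by metis
qed

lemma \<Phi>_in_Zinv_adj:
  assumes "n \<noteq> 0" "int (Suc N) dvd n" "c \<in> K" "entries_in (Zinv n) c" "entries_in (Zinv n) A"
  shows "\<Phi> c \<in> Zinv_adj n \<xi>"
  unfolding Zinv_adj_def ring_adjoin_def \<Phi>_def L_def using coord_in_Zinv[OF assms]
  by (intro CollectI exI[of _ N] exI[of _ "\<lambda>k. of_rat ((T *\<^sub>v (c *\<^sub>v v)) $ k)"]) auto

end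

section \<open>The symplectic and the Galois group\<close>

text \<open>By Lagrange every nontrivial element generates \<open>P\<close>; finiteness makes
  nonnegative exponents enough.\<close>

lemma (in group) prime_order_subgroup_cyclic:
  assumes P: "subgroup P G" and p: "Factorial_Ring.prime (card P)" and a: "a \<in> P" "a \<noteq> \<one>"
  shows "a [^] card P = \<one>" and "\<And>x. x \<in> P \<Longrightarrow> \<exists>k::nat. x = a [^] k"
proof -
  have aG: "a \<in> carrier G" using subgroup.subset[OF P] a by blast
  have fin: "finite P" using p by (metis card.infinite not_prime_0)
  interpret H: group "G\<lparr>carrier := P\<rparr>" by (rule subgroup.subgroup_is_group[OF P group_axioms])
  have pow: "a [^]\<^bsub>G\<lparr>carrier := P\<rparr>\<^esub> k = a [^] k" for k :: nat
    by (simp add: nat_pow_def)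
  have ord: "H.ord a dvd card P" using H.ord_dvd_group_order[of a] a by (simp add: Coset.order_def)
  moreover have "H.ord a \<noteq> 1" using H.ord_eq_1[of a] a by simp
  ultimately have ordp: "H.ord a = card P" using p by (auto simp: prime_nat_iff)
  show "a [^] card P = \<one>" using H.pow_ord_eq_1[of a] a pow ordp by simp
  have "card (generate (G\<lparr>carrier := P\<rparr>) {a}) = card P" using H.generate_pow_card[of a] a ordp by simp
  moreover have "generate (G\<lparr>carrier := P\<rparr>) {a} \<subseteq> P" using H.generate_incl[of "{a}"] a by simp
  ultimately have gen: "generate (G\<lparr>carrier := P\<rparr>) {a} = P" using fin by (simp add: card_subset_eq)
  show "\<exists>k::nat. x = a [^] k" if "x \<in> P" for x
    using that H.generate_pow_on_finite_carrier[of a] fin a pow unfolding gen by auto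
qed

lemma (in group) subgroup_normalizer_of:
  assumes H: "H \<subseteq> carrier G" shows "subgroup (normalizer_of G H) G"
proof
  show "normalizer_of G H \<subseteq> carrier G" by (auto simp: normalizer_of_def)
  have "(\<lambda>h. \<one> \<otimes> h \<otimes> inv \<one>) ` H = id ` H" by (rule image_cong) (use H in auto)
  then show "\<one> \<in> normalizer_of G H" by (simp add: normalizer_of_def)
next
  fix x y assume x: "x \<in> normalizer_of G H" and y: "y \<in> normalizer_of G H"
  have xG: "x \<in> carrier G" and yG: "y \<in> carrier G" using x y by (auto simp: normalizer_of_def)
  have "(\<lambda>h. (x \<otimes> y) \<otimes> h \<otimes> inv (x \<otimes> y)) ` H = (\<lambda>h. x \<otimes> h \<otimes> inv x) ` (\<lambda>h. y \<otimes> h \<otimes> inv y) ` H"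
    unfolding image_image by (rule image_cong) (use H xG yG in \<open>auto simp: inv_mult_group m_assoc subset_iff\<close>)
  also have "\<dots> = H" using x y by (simp add: normalizer_of_def)
  finally show "x \<otimes> y \<in> normalizer_of G H" using xG yG by (simp add: normalizer_of_def)
next
  fix x assume x: "x \<in> normalizer_of G H"
  have xG: "x \<in> carrier G" using x by (auto simp: normalizer_of_def)
  have "(\<lambda>h. inv x \<otimes> h \<otimes> inv (inv x)) ` H = (\<lambda>h. inv x \<otimes> h \<otimes> inv (inv x)) ` (\<lambda>h. x \<otimes> h \<otimes> inv x) ` H"
    using x by (simp add: normalizer_of_def)
  also have "\<dots> = id ` H"
    unfolding image_image by (rule image_cong) (use H xG in \<open>auto simp: m_assoc subset_iff inv_solve_left'\<close>)
  finally show "inv x \<in> normalizer_of G H" using xG by (simp add: normalizer_of_def)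
qed

section \<open>The symplectic group over Z[1/n]\<close>

lemma J_mat_carrier: "J_mat m \<in> carrier_mat (2*m) (2*m)" by (simp add: J_mat_def)

lemma J_mat_square: "J_mat m * J_mat m = - (1\<^sub>m (2*m))"
proof (rule eq_matI)
  fix i j assume ij: "i < dim_row (- (1\<^sub>m (2*m)) :: rat mat)" "j < dim_col (- (1\<^sub>m (2*m)) :: rat mat)"
  then have i: "i < 2*m" and j: "j < 2*m" by auto
  let ?s = "if i < m then i + m else i - m"
  have s: "?s < 2*m" using i by auto
  have row: "J_mat m $$ (i, k) = (if k = ?s then if i < m then 1 else -1 else 0)" if "k < 2*m" for k
    using i that by (auto simp: J_mat_def)
  have "(J_mat m * J_mat m) $$ (i, j) = (\<Sum>k<2*m. J_mat m $$ (i, k) * J_mat m $$ (k, j))"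
    using i j by (simp add: J_mat_def scalar_prod_def lessThan_atLeast0)
  also have "\<dots> = (\<Sum>k<2*m. if k = ?s then (if i < m then 1 else -1) * J_mat m $$ (?s, j) else 0)"
    by (rule sum.cong[OF refl]) (auto simp: row)
  also have "\<dots> = (if i < m then 1 else -1) * J_mat m $$ (?s, j)" using s by (subst sum.delta) auto
  also have "\<dots> = (- (1\<^sub>m (2*m))) $$ (i, j)" using i j s by (auto simp: J_mat_def)
  finally show "(J_mat m * J_mat m) $$ (i, j) = (- (1\<^sub>m (2*m))) $$ (i, j)" .
qed (auto simp: J_mat_def)

lemma entries_in_J_mat: "entries_in (Zinv n) (J_mat m)"
  using Zinv_of_int[of 0 n] Zinv_of_int[of 1 n] Zinv_of_int[of "-1" n] by (auto simp: entries_in_def J_mat_def)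

lemma Sp_grp_simps [simp]:
  "x \<otimes>\<^bsub>Sp_grp m n\<^esub> y = x * y" "\<one>\<^bsub>Sp_grp m n\<^esub> = 1\<^sub>m (2*m)"
  by (simp_all add: Sp_grp_def)

lemma carrier_Sp_grp: "M \<in> carrier (Sp_grp m n) \<longleftrightarrow>
    M \<in> carrier_mat (2*m) (2*m) \<and> entries_in (Zinv n) M \<and> transpose_mat M * J_mat m * M = J_mat m"
  by (auto simp: Sp_grp_def entries_in_def)

lemma symplectic_mult:
  fixes J :: "'a::comm_ring_1 mat"
  assumes J: "J \<in> carrier_mat k k" and M: "M \<in> carrier_mat k k" and M': "M' \<in> carrier_mat k k"
  shows "transpose_mat (M * M') * J * (M * M') = transpose_mat M' * (transpose_mat M * J * M) * M'"
  using assms by (simp add: transpose_mult[OF M M'] assoc_mult_mat[of _ k k _ k _ k])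

lemma group_Sp_grp: assumes n: "n \<noteq> 0" shows "group (Sp_grp m n)"
proof (rule groupI)
  let ?J = "J_mat m" and ?k = "2*m"
  note J = J_mat_carrier[of m]
  note assoc = assoc_mult_mat[of _ ?k ?k _ ?k _ ?k]
  show "x \<otimes>\<^bsub>Sp_grp m n\<^esub> y \<in> carrier (Sp_grp m n)"
    if "x \<in> carrier (Sp_grp m n)" "y \<in> carrier (Sp_grp m n)" for x y
    using that n symplectic_mult[OF J, of x y] by (auto simp: carrier_Sp_grp intro: entries_in_mult)
  show "\<one>\<^bsub>Sp_grp m n\<^esub> \<in> carrier (Sp_grp m n)"
    using J by (simp add: carrier_Sp_grp entries_in_one)
  show "x \<otimes>\<^bsub>Sp_grp m n\<^esub> y \<otimes>\<^bsub>Sp_grp m n\<^esub> z = x \<otimes>\<^bsub>Sp_grp m n\<^esub> (y \<otimes>\<^bsub>Sp_grp m n\<^esub> z)"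
    if "x \<in> carrier (Sp_grp m n)" "y \<in> carrier (Sp_grp m n)" "z \<in> carrier (Sp_grp m n)" for x y z
    using that by (simp add: carrier_Sp_grp assoc)
  show "\<one>\<^bsub>Sp_grp m n\<^esub> \<otimes>\<^bsub>Sp_grp m n\<^esub> x = x" if "x \<in> carrier (Sp_grp m n)" for x
    using that left_mult_one_mat by (auto simp: carrier_Sp_grp)
  fix M assume "M \<in> carrier (Sp_grp m n)"
  then have M: "M \<in> carrier_mat ?k ?k" and ent: "entries_in (Zinv n) M" and symp: "transpose_mat M * ?J * M = ?J"
    by (auto simp: carrier_Sp_grp)
  have MT: "transpose_mat M \<in> carrier_mat ?k ?k" using M by simp
  \<comment> \<open>As -J inverts J, the symplectic relation says that -J M^T J is a left inverse of
    M. The formula involves no division, so the entries stay in Z[1/n].\<close>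
  define W where "W = - ?J * (transpose_mat M * ?J)"
  have W: "W \<in> carrier_mat ?k ?k" unfolding W_def using J MT by simp
  have "W * M = - ?J * (transpose_mat M * ?J * M)"
    unfolding W_def using J MT M by (simp add: assoc)
  also have "\<dots> = 1\<^sub>m ?k" unfolding symp using J J_mat_square[of m] by simp
  finally have WM: "W * M = 1\<^sub>m ?k" .
  then have MW: "M * W = 1\<^sub>m ?k" by (rule mat_mult_left_right_inverse[OF W M])
  have "transpose_mat W * ?J * W = transpose_mat (M * W) * ?J * (M * W)"
    unfolding symplectic_mult[OF J M W] symp ..
  also have "\<dots> = ?J" unfolding MW using J by simp
  finally have sW: "transpose_mat W * ?J * W = ?J" .
  have "entries_in (Zinv n) (transpose_mat M)" using ent by (simp add: entries_in_def)
  moreover have "entries_in (Zinv n) (- ?J)" using entries_in_J_mat[of n m] by (simp add: entries_in_def Zinv_uminus)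
  ultimately have "entries_in (Zinv n) W"
    unfolding W_def using entries_in_J_mat[of n m] M J by (intro entries_in_mult[OF n]) auto
  then have "W \<in> carrier (Sp_grp m n)" using W sW by (simp add: carrier_Sp_grp)
  then show "\<exists>y\<in>carrier (Sp_grp m n). y \<otimes>\<^bsub>Sp_grp m n\<^esub> M = \<one>\<^bsub>Sp_grp m n\<^esub>" using WM by auto
qed

lemma Sp_grp_pow: "x [^]\<^bsub>Sp_grp m n\<^esub> (k::nat) = x ^\<^sub>m k" if "x \<in> carrier_mat (2*m) (2*m)"
  by (induction k) (use that in \<open>simp_all add: Sp_grp_def nat_pow_def\<close>)

section \<open>The Galois group\<close>

lemma is_subfield_Q_adj: "is_subfield (Q_adj x)"
  unfolding is_subfield_def Q_adj_def by blast

lemma carrier_Gal_grp: "\<sigma> \<in> carrier (Gal_grp x) \<longleftrightarrow> bij_betw \<sigma> (Q_adj x) (Q_adj x)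
    \<and> (\<forall>a\<in>Q_adj x. \<forall>b\<in>Q_adj x. \<sigma> (a + b) = \<sigma> a + \<sigma> b \<and> \<sigma> (a * b) = \<sigma> a * \<sigma> b)
    \<and> (\<forall>a. a \<notin> Q_adj x \<longrightarrow> \<sigma> a = a)"
  by (simp add: Gal_grp_def)

lemma Gal_grp_simps [simp]: "\<sigma> \<otimes>\<^bsub>Gal_grp x\<^esub> \<tau> = \<sigma> \<circ> \<tau>" "\<one>\<^bsub>Gal_grp x\<^esub> = id"
  by (simp_all add: Gal_grp_def)

lemma group_Gal_grp: "group (Gal_grp x)"
proof (rule groupI)
  let ?Q = "Q_adj x"
  show "\<sigma> \<otimes>\<^bsub>Gal_grp x\<^esub> \<tau> \<in> carrier (Gal_grp x)"
    if s: "\<sigma> \<in> carrier (Gal_grp x)" and t: "\<tau> \<in> carrier (Gal_grp x)" for \<sigma> \<tau>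
  proof -
    have "bij_betw (\<sigma> \<circ> \<tau>) ?Q ?Q" using s t by (auto simp: carrier_Gal_grp intro: bij_betw_trans)
    moreover have "\<tau> a \<in> ?Q" if "a \<in> ?Q" for a using t that by (auto simp: carrier_Gal_grp dest: bij_betwE)
    ultimately show ?thesis using s t by (simp add: carrier_Gal_grp)
  qed
  show "\<one>\<^bsub>Gal_grp x\<^esub> \<in> carrier (Gal_grp x)" by (simp add: carrier_Gal_grp)
  show "\<sigma> \<otimes>\<^bsub>Gal_grp x\<^esub> \<tau> \<otimes>\<^bsub>Gal_grp x\<^esub> \<upsilon> = \<sigma> \<otimes>\<^bsub>Gal_grp x\<^esub> (\<tau> \<otimes>\<^bsub>Gal_grp x\<^esub> \<upsilon>)" for \<sigma> \<tau> \<upsilon>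
    by (simp add: comp_assoc)
  show "\<one>\<^bsub>Gal_grp x\<^esub> \<otimes>\<^bsub>Gal_grp x\<^esub> \<sigma> = \<sigma>" for \<sigma> by simp
  fix \<sigma> assume s: "\<sigma> \<in> carrier (Gal_grp x)"
  then have bij: "bij_betw \<sigma> ?Q ?Q"
    and hom: "\<And>a b. a \<in> ?Q \<Longrightarrow> b \<in> ?Q \<Longrightarrow> \<sigma> (a + b) = \<sigma> a + \<sigma> b \<and> \<sigma> (a * b) = \<sigma> a * \<sigma> b"
    and out: "\<And>a. a \<notin> ?Q \<Longrightarrow> \<sigma> a = a" by (auto simp: carrier_Gal_grp)
  \<comment> \<open>Outside Q(\<xi>) the inverse must be the identity, so that composition gives
    \<open>id\<close> on all complex numbers.\<close>
  define \<tau> where "\<tau> a = (if a \<in> ?Q then inv_into ?Q \<sigma> a else a)" for a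
  have inj: "inj_on \<sigma> ?Q" and im: "\<sigma> ` ?Q = ?Q" using bij by (auto simp: bij_betw_def)
  have tQ: "\<tau> a \<in> ?Q" and st: "\<sigma> (\<tau> a) = a" if "a \<in> ?Q" for a
    using that im by (auto simp: \<tau>_def inv_into_into f_inv_into_f)
  have ts: "\<tau> (\<sigma> a) = a" if "a \<in> ?Q" for a
  proof -
    have "\<sigma> a \<in> ?Q" using im that by blast
    then show ?thesis using inv_into_f_f[OF inj that] by (simp add: \<tau>_def)
  qed
  note Q = is_subfield_Q_adj[of x]
  have "\<tau> \<in> carrier (Gal_grp x)"
    unfolding carrier_Gal_grp
  proof (intro conjI ballI allI impI)
    have "bij_betw (inv_into ?Q \<sigma>) ?Q ?Q" by (rule bij_betw_inv_into[OF bij])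
    then show "bij_betw \<tau> ?Q ?Q" by (rule bij_betw_cong[THEN iffD1, rotated]) (simp add: \<tau>_def)
    fix a b assume ab: "a \<in> ?Q" "b \<in> ?Q"
    have "\<tau> (\<sigma> (\<tau> a + \<tau> b)) = \<tau> a + \<tau> b" by (rule ts) (use ab tQ subfield_add[OF Q] in auto)
    then show "\<tau> (a + b) = \<tau> a + \<tau> b" using hom[of "\<tau> a" "\<tau> b"] ab tQ st by simp
    have "\<tau> (\<sigma> (\<tau> a * \<tau> b)) = \<tau> a * \<tau> b" by (rule ts) (use ab tQ subfield_mult[OF Q] in auto)
    then show "\<tau> (a * b) = \<tau> a * \<tau> b" using hom[of "\<tau> a" "\<tau> b"] ab tQ st by simp
  qed (simp add: \<tau>_def)
  moreover have "\<tau> \<circ> \<sigma> = id"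
  proof
    fix a show "(\<tau> \<circ> \<sigma>) a = id a"
      by (cases "a \<in> ?Q") (use ts out in \<open>auto simp: \<tau>_def\<close>)
  qed
  ultimately show "\<exists>\<tau>\<in>carrier (Gal_grp x). \<tau> \<otimes>\<^bsub>Gal_grp x\<^esub> \<sigma> = \<one>\<^bsub>Gal_grp x\<^esub>" by auto
qed

section \<open>The Galois action by conjugation\<close>

text \<open>Since A^p - 1 = (1 + A + ... + A^(p-1))(A - 1) vanishes, every vector in the image of A
  - 1 has orbit sum zero. As \<open>A\<close> is not the identity, this image contains a nonzero
  vector.\<close>

lemma cyclotomic_module_exists:
  fixes A :: "rat mat"
  assumes p: "Factorial_Ring.prime (Suc N)" and A: "A \<in> carrier_mat N N"
    and Ap: "A ^\<^sub>m Suc N = 1\<^sub>m N" and A1: "A \<noteq> 1\<^sub>m N"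
    and \<xi>: "\<xi> ^ Suc N = 1" "\<xi> \<noteq> 1"
  shows "\<exists>v. cyclotomic_module N A v \<xi>"
proof -
  have "\<exists>i j. i < N \<and> j < N \<and> A $$ (i, j) \<noteq> 1\<^sub>m N $$ (i, j)"
  proof (rule ccontr)
    assume "\<not> ?thesis"
    then have "A = 1\<^sub>m N" using A by (intro eq_matI) auto
    then show False using A1 by simp
  qed
  then obtain i j where ij: "i < N" "j < N" "A $$ (i, j) \<noteq> 1\<^sub>m N $$ (i, j)" by blast
  define w :: "rat vec" where "w = unit_vec N j"
  define v where "v = A *\<^sub>v w - w"
  have w: "w \<in> carrier_vec N" by (simp add: w_def)
  have v: "v \<in> carrier_vec N" using A w by (simp add: v_def)
  have "v $ i \<noteq> 0" using ij A by (simp add: v_def w_def scalar_prod_right_unit row_def)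
  then have v0: "v \<noteq> 0\<^sub>v N" using ij by auto
  have pow: "A ^\<^sub>m k \<in> carrier_mat N N" for k using A by simp
  have pow_v: "A ^\<^sub>m k *\<^sub>v v = A ^\<^sub>m Suc k *\<^sub>v w - A ^\<^sub>m k *\<^sub>v w" for k
    unfolding v_def using mult_minus_distrib_mat_vec[OF pow[of k] mult_mat_vec_carrier[OF A w] w]
      assoc_mult_mat_vec[OF pow[of k] A w] by simp
  \<comment> \<open>The orbit sum of \<open>A w - w\<close> telescopes; at \<open>m = p\<close> it
    is zero because A^p = 1.\<close>
  have tele: "(\<Sum>k<m. (A ^\<^sub>m k *\<^sub>v v) $ l) = (A ^\<^sub>m m *\<^sub>v w) $ l - w $ l" if l: "l < N" for l m
  proof (induction m)
    case 0
    then show ?case using A w by simp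
  next
    case (Suc m)
    have "(A ^\<^sub>m m *\<^sub>v v) $ l = (A ^\<^sub>m Suc m *\<^sub>v w) $ l - (A ^\<^sub>m m *\<^sub>v w) $ l"
      unfolding pow_v using l pow[of m] by (subst index_minus_vec(1)) auto
    then show ?case using Suc by simp
  qed
  have "vec_lincomb N (Suc N) (\<lambda>_. 1) (\<lambda>k. A ^\<^sub>m k *\<^sub>v v) = 0\<^sub>v N"
  proof (rule eq_vecI)
    fix l assume "l < dim_vec (0\<^sub>v N :: rat vec)"
    then have l: "l < N" by simp
    have "vec_lincomb N (Suc N) (\<lambda>_. 1) (\<lambda>k. A ^\<^sub>m k *\<^sub>v v) $ l = (\<Sum>k<Suc N. (A ^\<^sub>m k *\<^sub>v v) $ l)"
      using l by (simp only: vec_lincomb_def index_vec mult_1)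
    also have "\<dots> = (1\<^sub>m N *\<^sub>v w) $ l - w $ l" unfolding tele[OF l] Ap ..
    also have "\<dots> = 0\<^sub>v N $ l" using w l by simp
    finally show "vec_lincomb N (Suc N) (\<lambda>_. 1) (\<lambda>k. A ^\<^sub>m k *\<^sub>v v) $ l = 0\<^sub>v N $ l" .
  qed (simp add: vec_lincomb_def)
  then have "cyclotomic_module N A v \<xi>" using p A Ap v v0 \<xi> by unfold_locales
  then show ?thesis by blast
qed

context cyclotomic_module
begin

text \<open>The inverse is carried along as \<open>h\<close>, so conjugation is plain matrix algebra
  and swapping the two arguments inverts it.\<close>

definition normalizing_pair :: "rat mat \<Rightarrow> rat mat \<Rightarrow> bool" where
  "normalizing_pair g h \<longleftrightarrow> g \<in> carrier_mat N N \<and> h \<in> carrier_mat N N \<and> g * h = 1\<^sub>m N \<and> h * g = 1\<^sub>m N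
     \<and> (\<forall>c\<in>K. g * c * h \<in> K \<and> h * c * g \<in> K)"

definition galois :: "rat mat \<Rightarrow> rat mat \<Rightarrow> complex \<Rightarrow> complex" where
  "galois g h x = (if x \<in> Q_adj \<xi> then \<Phi> (g * inv_into K \<Phi> x * h) else x)"

lemma \<Phi>_in_Q_adj: "c \<in> K \<Longrightarrow> \<Phi> c \<in> Q_adj \<xi>" using image_\<Phi> by blast

lemma galois_\<Phi>: "c \<in> K \<Longrightarrow> galois g h (\<Phi> c) = \<Phi> (g * c * h)"
  by (simp add: galois_def \<Phi>_in_Q_adj inv_into_f_f[OF inj_on_\<Phi>])

lemmas assoc_N = assoc_mult_mat[of _ N N _ N _ N]

lemma cancel_left:
  fixes c :: "'a::semiring_1 mat"
  assumes "g \<in> carrier_mat N N" "h \<in> carrier_mat N N" "g * h = 1\<^sub>m N" "c \<in> carrier_mat N N"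
  shows "g * (h * c) = c"
  using assms assoc_mult_mat[of g N N h N c N] left_mult_one_mat[of c N N] by simp

lemma conj_mult:
  assumes "normalizing_pair g h" "c \<in> carrier_mat N N" "d \<in> carrier_mat N N"
  shows "g * (c * d) * h = (g * c * h) * (g * d * h)"
  using assms cancel_left[of h g] by (simp add: normalizing_pair_def assoc_N mult_carrier_mat[of _ N N])

lemma conj_add:
  assumes "normalizing_pair g h" "c \<in> carrier_mat N N" "d \<in> carrier_mat N N"
  shows "g * (c + d) * h = g * c * h + g * d * h"
proof -
  have g: "g \<in> carrier_mat N N" and h: "h \<in> carrier_mat N N" using assms by (auto simp: normalizing_pair_def)
  show ?thesis using mult_add_distrib_mat[OF g assms(2,3)]
      add_mult_distrib_mat[OF mult_carrier_mat[OF g assms(2)] mult_carrier_mat[OF g assms(3)] h] by simp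
qed

lemma galois_in_Gal: assumes gh: "normalizing_pair g h" shows "galois g h \<in> carrier (Gal_grp \<xi>)"
  unfolding carrier_Gal_grp
proof (intro conjI ballI allI impI)
  have K1: "g * c * h \<in> K" and K2: "h * c * g \<in> K" if "c \<in> K" for c
    using gh that by (auto simp: normalizing_pair_def)
  have gm: "g \<in> carrier_mat N N" and hm: "h \<in> carrier_mat N N" and 1: "g * h = 1\<^sub>m N" "h * g = 1\<^sub>m N"
    using gh by (auto simp: normalizing_pair_def)
  have inv1: "g * (h * c * g) * h = c" and inv2: "h * (g * c * h) * g = c" if "c \<in> K" for c
    using cancel_left[OF gm hm 1(1)] cancel_left[OF hm gm 1(2)] K_carrier[OF that] gm hm 1 right_mult_one_mat[OF K_carrier[OF that]]
    by (simp_all add: assoc_N mult_carrier_mat[of _ N N])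
  have lift: "\<exists>c\<in>K. x = \<Phi> c" if "x \<in> Q_adj \<xi>" for x using that image_\<Phi> by blast
  show "bij_betw (galois g h) (Q_adj \<xi>) (Q_adj \<xi>)"
  \<comment> \<open>The inverse automorphism is conjugation by the swapped pair.\<close>
  proof (rule bij_betw_byWitness[where f' = "galois h g"])
    show "\<forall>x\<in>Q_adj \<xi>. galois h g (galois g h x) = x" "\<forall>x\<in>Q_adj \<xi>. galois g h (galois h g x) = x"
      using lift K1 K2 inv1 inv2 by (auto dest!: lift simp: galois_\<Phi>)
    show "galois g h ` Q_adj \<xi> \<subseteq> Q_adj \<xi>" "galois h g ` Q_adj \<xi> \<subseteq> Q_adj \<xi>"
      using K1 K2 by (auto dest!: lift simp: galois_\<Phi> \<Phi>_in_Q_adj)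
  qed
  fix a b assume "a \<in> Q_adj \<xi>" "b \<in> Q_adj \<xi>"
  then obtain c d where cd: "c \<in> K" "d \<in> K" and ab: "a = \<Phi> c" "b = \<Phi> d" using lift by blast
  note carr = K_carrier[OF cd(1)] K_carrier[OF cd(2)]
  show "galois g h (a + b) = galois g h a + galois g h b"
    unfolding ab \<Phi>_add[OF cd, symmetric] galois_\<Phi>[OF K_add[OF cd]] galois_\<Phi>[OF cd(1)] galois_\<Phi>[OF cd(2)]
      conj_add[OF gh carr] by (rule \<Phi>_add[OF K1[OF cd(1)] K1[OF cd(2)]])
  show "galois g h (a * b) = galois g h a * galois g h b"
    unfolding ab \<Phi>_mult[OF cd, symmetric] galois_\<Phi>[OF K_mult[OF cd]] galois_\<Phi>[OF cd(1)] galois_\<Phi>[OF cd(2)]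
      conj_mult[OF gh carr] by (rule \<Phi>_mult[OF K1[OF cd(1)] K1[OF cd(2)]])
qed (simp add: galois_def)

lemma galois_mult:
  assumes gh: "normalizing_pair g h" and gh': "normalizing_pair g' h'"
  shows "galois (g * g') (h' * h) = galois g h \<circ> galois g' h'"
proof
  fix x show "galois (g * g') (h' * h) x = (galois g h \<circ> galois g' h') x"
  proof (cases "x \<in> Q_adj \<xi>")
    case True
    then obtain c where c: "c \<in> K" "x = \<Phi> c" using image_\<Phi> by blast
    have "g' * c * h' \<in> K" using gh' c by (simp add: normalizing_pair_def)
    moreover have "g * g' * c * (h' * h) = g * (g' * c * h') * h"
      using gh gh' K_carrier[OF c(1)] by (simp add: normalizing_pair_def assoc_N mult_carrier_mat[of _ N N])
    ultimately show ?thesis by (simp add: c galois_\<Phi>)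
  qed (simp add: galois_def)
qed

text \<open>Fixing \<xi>, the image of \<open>A\<close>, means that \<open>g\<close> commutes with
  \<open>A\<close>. Conversely \<open>K\<close> is commutative, so conjugation by one of its
  elements is trivial on it.\<close>

lemma galois_eq_id_iff:
  assumes gh: "normalizing_pair g h" shows "galois g h = id \<longleftrightarrow> g \<in> K"
proof
  have gm: "g \<in> carrier_mat N N" and hm: "h \<in> carrier_mat N N" and 1: "g * h = 1\<^sub>m N" "h * g = 1\<^sub>m N"
    using gh by (auto simp: normalizing_pair_def)
  { assume "galois g h = id"
    then have "\<Phi> (g * A * h) = \<Phi> A" using galois_\<Phi>[OF K_A, of g h] by simp
    moreover have "g * A * h \<in> K" using gh K_A by (simp add: normalizing_pair_def)
    ultimately have "g * A * h = A" using inj_onD[OF inj_on_\<Phi>] K_A by blast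
    then have "A * g = g * A * h * g" by simp
    also have "\<dots> = g * A" using gm hm 1 right_mult_one_mat[OF A] by (simp add: assoc_N mult_carrier_mat[of _ N N])
    finally show "g \<in> K" using gm by (simp add: K_def) }
  assume g: "g \<in> K"
  have "g * c * h = c" if c: "c \<in> K" for c
    unfolding K_commute[OF g c] using K_carrier[OF c] gm hm 1 right_mult_one_mat[OF K_carrier[OF c]] by (simp add: assoc_N)
  then have "galois g h x = x" for x
  proof (cases "x \<in> Q_adj \<xi>")
    case True
    then obtain c where "c \<in> K" "x = \<Phi> c" using image_\<Phi> by blast
    then show ?thesis using \<open>\<And>c. c \<in> K \<Longrightarrow> g * c * h = c\<close> by (simp add: galois_\<Phi>)
  qed (simp add: galois_def)
  then show "galois g h = id" by auto
qed

text \<open>Describes \<open>K\<close> through \<open>P\<close> instead of a chosen generator,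
  because a normalizing matrix preserves \<open>P\<close> but may move \<open>A\<close>.\<close>

lemma K_eq_centralizer:
  assumes "A \<in> P" and "\<And>x. x \<in> P \<Longrightarrow> \<exists>k::nat. x = A ^\<^sub>m k"
  shows "K = {c \<in> carrier_mat N N. \<forall>x\<in>P. c * x = x * c}"
proof -
  have "c * x = x * c" if c: "c \<in> K" and "x \<in> P" for c x
  proof -
    obtain k where "x = A ^\<^sub>m k" using assms(2) \<open>x \<in> P\<close> by blast
    then show ?thesis using pow_mat_commute[OF K_carrier[OF c] A] c by (simp add: K_def)
  qed
  then show ?thesis using assms(1) by (auto simp: K_def)
qed

text \<open>Each \<open>x\<close> in \<open>P\<close> is \<open>g * y * h\<close> for some
  \<open>y\<close> in \<open>P\<close>; hence \<open>g * c * h\<close> commutes with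
  \<open>x\<close> because \<open>c\<close> commutes with \<open>y\<close>. The swapped pair also
  maps \<open>P\<close> onto itself, so the argument applies in both directions.\<close>

lemma normalizing_pairI:
  assumes K: "K = {c \<in> carrier_mat N N. \<forall>x\<in>P. c * x = x * c}" and P: "P \<subseteq> carrier_mat N N"
    and gm: "g \<in> carrier_mat N N" and hm: "h \<in> carrier_mat N N" and 1: "g * h = 1\<^sub>m N" "h * g = 1\<^sub>m N"
    and norm: "(\<lambda>x. g * x * h) ` P = P"
  shows "normalizing_pair g h"
proof -
  note simps = assoc_N mult_carrier_mat[of _ N N] cancel_left[OF gm hm 1(1)] cancel_left[OF hm gm 1(2)] gm hm 1
  have norm': "(\<lambda>x. h * x * g) ` P = P"
  proof -
    have "(\<lambda>x. h * x * g) ` (\<lambda>x. g * x * h) ` P = id ` P"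
      unfolding image_image by (rule image_cong[OF refl]) (use P right_mult_one_mat[of _ N N] in \<open>auto simp: simps subset_iff\<close>)
    then show ?thesis unfolding norm by simp
  qed
  have conj: "g * c * h \<in> K" if gm: "g \<in> carrier_mat N N" and hm: "h \<in> carrier_mat N N" and 1: "g * h = 1\<^sub>m N" "h * g = 1\<^sub>m N"
    and norm: "(\<lambda>x. g * x * h) ` P = P" and c: "c \<in> K" for g h c
  proof -
    note simps = assoc_N mult_carrier_mat[of _ N N] cancel_left[OF hm gm 1(2)] gm hm
    have cc: "c \<in> carrier_mat N N" using c by (rule K_carrier)
    have "g * c * h * x = x * (g * c * h)" if x: "x \<in> P" for x
    proof -
      have "x \<in> (\<lambda>x. g * x * h) ` P" unfolding norm by (rule x)
      then obtain y where y: "y \<in> P" "x = g * y * h" by blast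
      have ym: "y \<in> carrier_mat N N" using y P by blast
      have cy: "c * y = y * c" using c y K by blast
      have "g * c * h * x = g * (c * y) * h" unfolding y(2) using cc ym by (simp add: simps)
      also have "\<dots> = x * (g * c * h)" unfolding y(2) cy using cc ym by (simp add: simps)
      finally show ?thesis .
    qed
    then show ?thesis using cc gm hm by (subst K) (auto simp: mult_carrier_mat[of _ N N])
  qed
  show ?thesis unfolding normalizing_pair_def
    using gm hm 1 conj[OF gm hm 1 norm] conj[OF hm gm 1(2) 1(1) norm'] by blast
qed

end

theorem theorem4p3:
  fixes p :: nat and n :: int and \<xi> :: complex and P :: "rat mat set"
  assumes "Factorial_Ring.prime p" and "odd p"
    and "\<xi> ^ p = 1" and "\<forall>k. 0 < k \<and> k < p \<longrightarrow> \<xi> ^ k \<noteq> 1"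
    and "n \<noteq> 0" and "int p dvd n"
    and "is_PID (Zinv_adj n \<xi>)" and "is_PID (Zinv_adj n (\<xi> + inverse \<xi>))"
    and "subgroup P (Sp_grp ((p - 1) div 2) n)" and "card P = p"
  shows "let G = Sp_grp ((p - 1) div 2) n; N = normalizer_of G P; C = centralizer_of G P
         in (\<exists>\<phi> \<psi>. \<phi> \<in> hom (G\<lparr>carrier := C\<rparr>) (units_grp (Zinv_adj n \<xi>)) \<and> inj_on \<phi> C
               \<and> \<psi> \<in> hom ((G\<lparr>carrier := N\<rparr>) Mod C) (Gal_grp \<xi>) \<and> inj_on \<psi> (carrier ((G\<lparr>carrier := N\<rparr>) Mod C))
               \<and> (\<forall>g\<in>N. \<forall>c\<in>C. \<phi> (g \<otimes>\<^bsub>G\<^esub> c \<otimes>\<^bsub>G\<^esub> inv\<^bsub>G\<^esub> g) = \<psi> (C #>\<^bsub>G\<^esub> g) (\<phi> c)))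
          \<and> (\<forall>g\<in>N. (\<forall>c\<in>C. g \<otimes>\<^bsub>G\<^esub> c \<otimes>\<^bsub>G\<^esub> inv\<^bsub>G\<^esub> g = c) \<longrightarrow> g \<in> C)"
proof -
  define m where "m = (p - 1) div 2"
  define d where "d = p - 1"
  define G where "G = Sp_grp m n"
  define N where "N = normalizer_of G P"
  define C where "C = centralizer_of G P"
  have p2: "p \<ge> 2" using assms(1) by (rule prime_ge_2_nat)
  have Sd: "p = Suc d" using p2 by (simp add: d_def)
  have dm: "2 * m = d" using \<open>odd p\<close> by (simp add: m_def d_def)
  interpret G: group G unfolding G_def using assms(5) by (rule group_Sp_grp)
  have P: "subgroup P G" using assms(9) by (simp add: G_def m_def)
  have Gmult [simp]: "x \<otimes>\<^bsub>G\<^esub> y = x * y" and Gone [simp]: "\<one>\<^bsub>G\<^esub> = 1\<^sub>m d" for x y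
    by (simp_all add: G_def dm)
  have Gcarr: "x \<in> carrier_mat d d" and Gent: "entries_in (Zinv n) x" if "x \<in> carrier G" for x
    using that by (auto simp: G_def carrier_Sp_grp dm)
  have PG: "P \<subseteq> carrier G" using P by (rule subgroup.subset)
  have "\<exists>A\<in>P. A \<noteq> \<one>\<^bsub>G\<^esub>"
  proof (rule ccontr)
    assume "\<not> ?thesis"
    then have "P \<subseteq> {\<one>\<^bsub>G\<^esub>}" by blast
    then have "card P \<le> card {\<one>\<^bsub>G\<^esub>}" by (rule card_mono[rotated]) simp
    then show False using assms(10) p2 by simp
  qed
  then obtain A where A: "A \<in> P" "A \<noteq> \<one>\<^bsub>G\<^esub>" by blast
  have AG: "A \<in> carrier G" using A PG by blast
  have pow: "A [^]\<^bsub>G\<^esub> k = A ^\<^sub>m k" for k :: nat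
    unfolding G_def by (rule Sp_grp_pow) (use Gcarr[OF AG] dm in simp)
  have cyc: "\<exists>k::nat. x = A ^\<^sub>m k" if "x \<in> P" for x
    using G.prime_order_subgroup_cyclic(2)[OF P _ A that] assms(1,10) pow by simp
  have "A ^\<^sub>m Suc d = 1\<^sub>m d"
    using G.prime_order_subgroup_cyclic(1)[OF P _ A] assms(1,10) pow Sd by simp
  moreover have "\<xi> ^ Suc d = 1" "\<xi> \<noteq> 1" using assms(3,4) p2 Sd by (auto dest: spec[of _ 1])
  ultimately obtain v where "cyclotomic_module d A v \<xi>"
    using cyclotomic_module_exists[of d A \<xi>] assms(1) Sd Gcarr[OF AG] A(2) by auto
  then interpret M: cyclotomic_module d A v \<xi> .
  have K: "M.K = {c \<in> carrier_mat d d. \<forall>x\<in>P. c * x = x * c}"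
    using A(1) cyc by (rule M.K_eq_centralizer)
  have C: "C = carrier G \<inter> M.K"
    unfolding C_def centralizer_of_def K using Gcarr by auto
  have inv: "inv\<^bsub>G\<^esub> g \<in> carrier G" "g * inv\<^bsub>G\<^esub> g = 1\<^sub>m d" "inv\<^bsub>G\<^esub> g * g = 1\<^sub>m d" if "g \<in> carrier G" for g
    using that G.r_inv[OF that] G.l_inv[OF that] by auto
  have NG: "N \<subseteq> carrier G" by (auto simp: N_def normalizer_of_def)
  have pair: "M.normalizing_pair g (inv\<^bsub>G\<^esub> g)" if g: "g \<in> N" for g
  proof (rule M.normalizing_pairI[OF K])
    have gG: "g \<in> carrier G" using g NG by blast
    show "P \<subseteq> carrier_mat d d" using PG Gcarr by blast
    show "g \<in> carrier_mat d d" "inv\<^bsub>G\<^esub> g \<in> carrier_mat d d" using Gcarr gG inv by auto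
    show "g * inv\<^bsub>G\<^esub> g = 1\<^sub>m d" "inv\<^bsub>G\<^esub> g * g = 1\<^sub>m d" using inv[OF gG] by auto
    show "(\<lambda>x. g * x * inv\<^bsub>G\<^esub> g) ` P = P" using g by (simp add: N_def normalizer_of_def)
  qed
  \<comment> \<open>The action is built on the normalizer first; its kernel turns out to be
    \<open>C\<close>, which gives injectivity after passing to the quotient.\<close>
  define \<theta> where "\<theta> g = M.galois g (inv\<^bsub>G\<^esub> g)" for g
  have Nsub: "subgroup N G" unfolding N_def using PG by (rule G.subgroup_normalizer_of)
  have CN: "C \<subseteq> N"
  proof
    fix c assume c: "c \<in> C"
    then have cG: "c \<in> carrier G" and comm: "\<And>x. x \<in> P \<Longrightarrow> c \<otimes>\<^bsub>G\<^esub> x = x \<otimes>\<^bsub>G\<^esub> c"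
      by (auto simp: C_def centralizer_of_def)
    have "(\<lambda>x. c \<otimes>\<^bsub>G\<^esub> x \<otimes>\<^bsub>G\<^esub> inv\<^bsub>G\<^esub> c) ` P = id ` P"
    proof (rule image_cong[OF refl])
      fix x assume x: "x \<in> P"
      show "c \<otimes>\<^bsub>G\<^esub> x \<otimes>\<^bsub>G\<^esub> inv\<^bsub>G\<^esub> c = id x"
        unfolding comm[OF x] using G.m_assoc[of x c "inv\<^bsub>G\<^esub> c"] cG x PG by (auto simp del: Gmult Gone)
    qed
    then show "c \<in> N" using cG by (simp add: N_def normalizer_of_def)
  qed
  have hom: "\<theta> \<in> hom (G\<lparr>carrier := N\<rparr>) (Gal_grp \<xi>)"
  proof (rule homI)
    fix g g' assume "g \<in> carrier (G\<lparr>carrier := N\<rparr>)" "g' \<in> carrier (G\<lparr>carrier := N\<rparr>)"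
    then have g: "g \<in> N" "g' \<in> N" by auto
    then have "inv\<^bsub>G\<^esub> (g * g') = inv\<^bsub>G\<^esub> g' * inv\<^bsub>G\<^esub> g" using G.inv_mult_group[of g g'] NG by auto
    then show "\<theta> (g \<otimes>\<^bsub>G\<lparr>carrier := N\<rparr>\<^esub> g') = \<theta> g \<otimes>\<^bsub>Gal_grp \<xi>\<^esub> \<theta> g'"
      using M.galois_mult[OF pair[OF g(1)] pair[OF g(2)]] by (simp add: \<theta>_def)
  qed (use M.galois_in_Gal[OF pair] in \<open>simp add: \<theta>_def\<close>)
  interpret \<theta>: group_hom "G\<lparr>carrier := N\<rparr>" "Gal_grp \<xi>" \<theta>
    using hom subgroup.subgroup_is_group[OF Nsub G.group_axioms] group_Gal_grp
    by (simp add: group_hom_def group_hom_axioms_def)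
  have ker: "kernel (G\<lparr>carrier := N\<rparr>) (Gal_grp \<xi>) \<theta> = C"
    unfolding kernel_def using M.galois_eq_id_iff[OF pair] NG CN by (auto simp: \<theta>_def C)
  \<comment> \<open>The first isomorphism theorem: \<open>\<theta>\<close> is constant on each
    coset, and \<open>the_elem\<close> picks that common value.\<close>
  define \<psi> where "\<psi> Y = the_elem (\<theta> ` Y)" for Y
  have \<psi>: "\<psi> \<in> hom ((G\<lparr>carrier := N\<rparr>) Mod C) (Gal_grp \<xi>)" "inj_on \<psi> (carrier ((G\<lparr>carrier := N\<rparr>) Mod C))"
    using \<theta>.FactGroup_hom \<theta>.FactGroup_inj_on unfolding ker \<psi>_def[abs_def] by auto
  have \<psi>_coset: "\<psi> (C #>\<^bsub>G\<^esub> g) = \<theta> g" if g: "g \<in> N" for g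
  proof -
    have "\<theta> (c * g) = \<theta> g" if c: "c \<in> C" for c
    proof -
      have "c \<in> kernel (G\<lparr>carrier := N\<rparr>) (Gal_grp \<xi>) \<theta>" using c ker by simp
      then have "\<theta> c = id" "c \<in> N" by (auto simp: kernel_def)
      then show ?thesis using \<theta>.hom_mult[of c g] g by simp
    qed
    moreover have "\<one>\<^bsub>G\<^esub> \<in> C" using G.one_closed M.K_1 by (simp add: C del: G.one_closed)
    ultimately have "\<theta> ` (C #>\<^bsub>G\<^esub> g) = {\<theta> g}" by (auto simp: r_coset_def image_UN)
    then show ?thesis by (simp add: \<psi>_def)
  qed
  have CK: "c \<in> M.K" and CG: "c \<in> carrier G" if "c \<in> C" for c using that C by auto
  have unit: "M.\<Phi> c \<in> Zinv_adj n \<xi>" if c: "c \<in> C" for c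
    using M.\<Phi>_in_Zinv_adj[OF assms(5) _ CK[OF c] Gent[OF CG[OF c]] Gent[OF AG]] assms(6) Sd by simp
  \<comment> \<open>The group inverse of \<open>c\<close> again lies in \<open>C\<close>, so its
    image is in the same ring and witnesses that the image of \<open>c\<close> is a unit.\<close>
  have \<phi>: "M.\<Phi> \<in> hom (G\<lparr>carrier := C\<rparr>) (units_grp (Zinv_adj n \<xi>))"
  proof (rule homI)
    fix c assume "c \<in> carrier (G\<lparr>carrier := C\<rparr>)"
    then have c: "c \<in> C" by simp
    note i = inv[OF CG[OF c]]
    have "inv\<^bsub>G\<^esub> c \<in> C"
      using M.K_inv[OF CK[OF c] Gcarr[OF i(1)] i(3) i(2)] i(1) C by simp
    moreover from this have "M.\<Phi> c * M.\<Phi> (inv\<^bsub>G\<^esub> c) = 1"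
      using M.\<Phi>_mult[OF CK[OF c] CK, of "inv\<^bsub>G\<^esub> c"] unfolding i(2) M.\<Phi>_1 by simp
    ultimately show "M.\<Phi> c \<in> carrier (units_grp (Zinv_adj n \<xi>))"
      using unit c by (auto simp: units_grp_def)
  next
    fix c c' assume "c \<in> carrier (G\<lparr>carrier := C\<rparr>)" "c' \<in> carrier (G\<lparr>carrier := C\<rparr>)"
    then show "M.\<Phi> (c \<otimes>\<^bsub>G\<lparr>carrier := C\<rparr>\<^esub> c') = M.\<Phi> c \<otimes>\<^bsub>units_grp (Zinv_adj n \<xi>)\<^esub> M.\<Phi> c'"
      using M.\<Phi>_mult CK by (simp add: units_grp_def)
  qed
  have inj: "inj_on M.\<Phi> C" using M.inj_on_\<Phi> by (rule inj_on_subset) (use CK in blast)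
  have act: "\<forall>g\<in>N. \<forall>c\<in>C. M.\<Phi> (g \<otimes>\<^bsub>G\<^esub> c \<otimes>\<^bsub>G\<^esub> inv\<^bsub>G\<^esub> g) = \<psi> (C #>\<^bsub>G\<^esub> g) (M.\<Phi> c)"
    using M.galois_\<Phi> CK by (simp add: \<psi>_coset \<theta>_def)
  have faithful: "\<forall>g\<in>N. (\<forall>c\<in>C. g \<otimes>\<^bsub>G\<^esub> c \<otimes>\<^bsub>G\<^esub> inv\<^bsub>G\<^esub> g = c) \<longrightarrow> g \<in> C"
  proof (intro ballI impI)
    fix g assume g: "g \<in> N" and triv: "\<forall>c\<in>C. g \<otimes>\<^bsub>G\<^esub> c \<otimes>\<^bsub>G\<^esub> inv\<^bsub>G\<^esub> g = c"
    have gG: "g \<in> carrier G" using g NG by blast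
    \<comment> \<open>Testing the trivial action on the single element \<open>A\<close> suffices,
      since commuting with \<open>A\<close> defines \<open>M.K\<close>.\<close>
    have "A \<in> C" using AG M.K_A by (simp add: C)
    then have "g \<otimes>\<^bsub>G\<^esub> A \<otimes>\<^bsub>G\<^esub> inv\<^bsub>G\<^esub> g = A" using triv by blast
    then have "A \<otimes>\<^bsub>G\<^esub> g = g \<otimes>\<^bsub>G\<^esub> A"
      using G.inv_solve_right'[of A "g \<otimes>\<^bsub>G\<^esub> A" g] gG AG by (simp del: Gmult)
    then show "g \<in> C" using gG Gcarr[OF gG] by (simp add: C M.K_def)
  qed
  from \<phi> inj \<psi> act faithful show ?thesis
    unfolding Let_def m_def[symmetric] G_def[symmetric] N_def[symmetric] C_def[symmetric] by blast
qed

end
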